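(* Let $K_1,\dots,K_n$ be convex bodies in $\mathbb{R}^n$ of class $C^2_+$ with centroid at the origin, and let $T:\mathbb{R}^n\to\mathbb{R}^n$ be an invertible linear transform. Then for all $p\ne-n$ (real, or $p=\pm\infty$), $$as_p(TK_1,\dots,TK_n)=|\det(T)|^{\frac{n-p}{n+p}}\,as_p(K_1,\dots,K_n).$$ In particular, if $|\det(T)|=1$, then $as_p(TK_1,\dots,TK_n)=as_p(K_1,\dots,K_n)$.
   Context: $K\in C^2_+$ means that $\partial K$ is of class $C^2$ with everywhere strictly positive Gauss curvature. $h_K$ is the support function of $K$; $f_K(u)$ is the reciprocal of the Gauss curvature of $\partial K$ at the unique boundary point with outer unit normal $u\in S^{n-1}$; $\sigma$ is the surface area measure on $S^{n-1}$. For real $p\ne-n$, $$as_p(K_1,\dots,K_n)=\int_{S^{n-1}}\big[h_{K_1}(u)^{1-p}f_{K_1}(u)\cdots h_{K_n}(u)^{1-p}f_{K_n}(u)\big]^{\frac1{n+p}}\,d\sigma(u),$$ and for $p=\pm\infty$, $as_{\pm\infty}(K_1,\dots,K_n)=\int_{S^{n-1}}\frac{1}{h_{K_1}(u)\cdots h_{K_n}(u)}\,d\sigma(u)$; the exponent $\frac{n-p}{n+p}$ is read as $-1$ for $p=\pm\infty$. *)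

theory Defs
  imports "HOL-Analysis.Analysis"
begin

definition convex_body :: "(real^'n) set \<Rightarrow> bool" where
  "convex_body K \<longleftrightarrow> compact K \<and> convex K \<and> interior K \<noteq> {}"

definition centroid :: "(real^'n) set \<Rightarrow> real^'n" where
  "centroid K = (LINT x:K|lborel. x) /\<^sub>R measure lborel K"

definition support_function :: "(real^'n) set \<Rightarrow> real^'n \<Rightarrow> real" where
  "support_function K u = (SUP x\<in>K. x \<bullet> u)"

definition outer_unit_normal :: "(real^'n) set \<Rightarrow> real^'n \<Rightarrow> real^'n \<Rightarrow> bool" where
  "outer_unit_normal K x u \<longleftrightarrow> x \<in> frontier K \<and> norm u = 1 \<and> (\<forall>y\<in>K. y \<bullet> u \<le> x \<bullet> u)"

text \<open>The function \<open>G\<close> is the gradient of \<open>g\<close>, and \<open>H\<close> is its Hessian matrix.\<close>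

definition C2_on :: "(real^'n) set \<Rightarrow> (real^'n \<Rightarrow> real) \<Rightarrow> bool" where
  "C2_on U g \<longleftrightarrow> (\<exists>(G :: real^'n \<Rightarrow> real^'n) (H :: real^'n \<Rightarrow> real^'n^'n).
     (\<forall>x\<in>U. (g has_derivative (\<lambda>v. G x \<bullet> v)) (at x)) \<and>
     (\<forall>x\<in>U. (G has_derivative (\<lambda>v. H x *v v)) (at x)) \<and>
     continuous_on U H)"

text \<open>A hypersurface of class \<open>C\<^sup>2\<close> is a set that is locally a regular level set of a
  \<open>C\<^sup>2\<close> function.\<close>

definition C2_hypersurface :: "(real^'n) set \<Rightarrow> bool" where
  "C2_hypersurface S \<longleftrightarrow> (\<forall>x\<in>S. \<exists>U g. open U \<and> x \<in> U \<and> C2_on U g \<and>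
     S \<inter> U = {y \<in> U. g y = 0} \<and>
     (\<forall>y\<in>U. \<not> (g has_derivative (\<lambda>v. 0)) (at y)))"

definition gauss_map :: "(real^'n) set \<Rightarrow> real^'n \<Rightarrow> real^'n" where
  "gauss_map K x = (THE u. outer_unit_normal K x u)"

text \<open>
  The Gauss curvature at \<open>x\<close> is the determinant of the Weingarten map, i.e. of the differential
  \<open>D\<close> of the Gauss map as an endomorphism of the tangent hyperplane \<open>\<nu>\<^sup>\<bottom>\<close>. To use the
  determinant of square matrices, this endomorphism is extended to the whole space by
  \<open>\<nu> \<mapsto> \<nu>\<close>, which does not change its determinant. The derivative of the Gauss map
  within the hypersurface is unique only on \<open>\<nu>\<^sup>\<bottom>\<close>, and it is applied only to such vectors.
  With the outer normal, the unit sphere gets curvature 1.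
\<close>

definition gauss_curvature :: "(real^'n) set \<Rightarrow> real^'n \<Rightarrow> real" where
  "gauss_curvature K x =
     (let \<nu> = gauss_map K x;
          D = frechet_derivative (gauss_map K) (at x within frontier K)
      in det (matrix (\<lambda>v. D (v - (v \<bullet> \<nu>) *\<^sub>R \<nu>) + (v \<bullet> \<nu>) *\<^sub>R \<nu>)))"

definition C2_plus :: "(real^'n) set \<Rightarrow> bool" where
  "C2_plus K \<longleftrightarrow> C2_hypersurface (frontier K) \<and> (\<forall>x\<in>frontier K. gauss_curvature K x > 0)"

definition curvature_function :: "(real^'n) set \<Rightarrow> real^'n \<Rightarrow> real" where
  "curvature_function K u =
     1 / gauss_curvature K (THE x. outer_unit_normal K x u)"

text \<open>
  The surface area of a Borel set \<open>A\<close> in the unit sphere is \<open>n\<close> times the volume of the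
  cone \<open>{t *\<^sub>R u | t u. 0 < t \<and> t \<le> 1 \<and> u \<in> A}\<close> over it. This is the measure for which
  integration in polar coordinates holds with the density \<open>r\<^sup>n\<^sup>-\<^sup>1\<close>.
\<close>

definition sphere_measure :: "(real^'n) measure" where
  "sphere_measure = scale_measure (of_nat CARD('n))
     (distr (restrict_space lborel (cball 0 1 - {0})) (restrict_space borel (sphere 0 1))
        (\<lambda>x. x /\<^sub>R norm x))"

text \<open>Only the bodies \<open>K 1, \<dots>, K n\<close>, where \<open>n = CARD('n)\<close>, are relevant.\<close>

definition mixed_affine_surface_area :: "ereal \<Rightarrow> (nat \<Rightarrow> (real^'n) set) \<Rightarrow> real" where
  "mixed_affine_surface_area p K =
     (if \<bar>p\<bar> = \<infinity>
      then LINT u|sphere_measure. 1 / (\<Prod>i=1..CARD('n). support_function (K i) u)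
      else let r = real_of_ereal p in
        LINT u|sphere_measure.
          (\<Prod>i=1..CARD('n). support_function (K i) u powr (1 - r) * curvature_function (K i) u)
            powr (1 / (real CARD('n) + r)))"

definition affine_exponent :: "nat \<Rightarrow> ereal \<Rightarrow> real" where
  "affine_exponent n p =
     (if \<bar>p\<bar> = \<infinity> then -1
      else (real n - real_of_ereal p) / (real n + real_of_ereal p))"

end

theory Submission
  imports Defs
begin

text \<open>
  Let \<open>L\<close> be the adjoint of \<open>T\<close> and \<open>v = L u / |L u|\<close>. A point \<open>x\<close> of the boundary of \<open>K\<close> has normal
  \<open>v\<close> iff \<open>T x\<close> has normal \<open>u\<close> in \<open>T K\<close>, so \<open>h\<^bsub>TK\<^esub> u = |L u| h\<^bsub>K\<^esub> v\<close>. Differentiating the relation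
  between the two Gauss maps gives \<open>f\<^bsub>TK\<^esub> u = (det T)\<^sup>2 |L u|\<^bsup>-(n+1)\<^esup> f\<^bsub>K\<^esub> v\<close>. Hence the integrand for
  \<open>T K\<close> at \<open>u\<close> is \<open>|det T|\<^bsup>2n/(n+p)\<^esup> |L u|\<^bsup>-n\<^esup>\<close> times the one for \<open>K\<close> at \<open>v\<close>, and the substitution
  \<open>u \<mapsto> v\<close> on the sphere, whose Jacobian is \<open>|det T| |L u|\<^bsup>-n\<^esup>\<close>, removes \<open>|L u|\<^bsup>-n\<^esup>\<close> and one power of
  \<open>|det T|\<close>. The substitution rule comes from the linear one, because the integral of \<open>h \<ge> 0\<close> over the
  sphere is \<open>n\<close> times the volume of the star-shaped set \<open>{x. |x|\<^sup>n < h (x / |x|)}\<close>.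
\<close>

section \<open>Determinants\<close>

lemma det_matrix_compose:
  fixes f g :: "real^'n \<Rightarrow> real^'n"
  assumes "linear f" "linear g"
  shows "det (matrix (\<lambda>x. g (f x))) = det (matrix g) * det (matrix f)"
  using matrix_compose[OF assms] by (simp add: o_def det_mul)

text \<open>An orthogonal map taking a coordinate axis to the unit vector \<open>b\<close> reduces
  the claim to the identity matrix with one column changed, where Cramer's lemma applies. The length
  of a general \<open>b\<close> is moved into \<open>a\<close>.\<close>

lemma det_rank_one_update:
  fixes a b :: "real^'n"
  shows "det (matrix (\<lambda>v. v + (v \<bullet> b) *\<^sub>R a)) = 1 + a \<bullet> b"
proof -
  have unit: "det (matrix (\<lambda>v. v + (v \<bullet> b) *\<^sub>R a)) = 1 + a \<bullet> b"
    if b: "norm b = 1" for a b :: "real^'n"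
  proof -
    define k where "k = (undefined :: 'n)"
    obtain R :: "real^'n \<Rightarrow> real^'n" where R: "orthogonal_transformation R" and Rk: "R (axis k 1) = b"
      using orthogonal_transformation_exists_1[of "axis k (1::real)" b] b by auto
    have lR: "linear R" using R by (rule orthogonal_transformation_linear)
    have surj: "surj R" using R by (rule orthogonal_transformation_surj)
    obtain a' where a': "R a' = a" using surj by (metis surjD)
    have ins: "R v \<bullet> R w = v \<bullet> w" for v w
      using R by (simp add: orthogonal_transformation_def)
    let ?F = "\<lambda>v. v + (v \<bullet> b) *\<^sub>R a" and ?F' = "\<lambda>v. v + (v $ k) *\<^sub>R a'"
    have lF: "linear ?F" by (intro linearI) (auto simp: algebra_simps inner_add_left)
    have lF': "linear ?F'" by (intro linearI) (auto simp: algebra_simps)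
    have conj: "?F (R v) = R (?F' v)" for v
      using ins[of v "axis k 1"]
      by (simp add: Rk linear_add[OF lR] linear_scale[OF lR] a' inner_axis)
    have "det (matrix ?F) * det (matrix R) = det (matrix R) * det (matrix ?F')"
      using det_matrix_compose[OF lR lF] det_matrix_compose[OF lF' lR] unfolding conj
      by (rule trans[OF sym])
    moreover have "det (matrix R) \<noteq> 0"
      using orthogonal_transformation_det[OF R] by auto
    ultimately have "det (matrix ?F) = det (matrix ?F')" by auto
    \<comment> \<open>Column \<open>k\<close> becomes \<open>axis k 1 + a'\<close>; the products
      with \<open>mat 1\<close> give the shape required by \<open>cramer_lemma\<close>.\<close>
    also have "matrix ?F' = (\<chi> i j. if j = k then (mat 1 *v (axis k 1 + a')) $ i else mat 1 $ i $ j)"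
      by (auto simp: matrix_def vec_eq_iff axis_def matrix_vector_mul_lid) (auto simp: mat_def)
    also have "det \<dots> = (axis k 1 + a') $ k"
      by (subst cramer_lemma) simp
    also have "\<dots> = 1 + a \<bullet> b"
      using ins[of a' "axis k 1"] by (simp add: Rk a' inner_axis)
    finally show ?thesis .
  qed
  show ?thesis
  proof (cases "b = 0")
    case True
    then show ?thesis by (simp add: matrix_id[unfolded id_def])
  next
    case False
    have "(\<lambda>v. v + (v \<bullet> b) *\<^sub>R a) = (\<lambda>v. v + (v \<bullet> (b /\<^sub>R norm b)) *\<^sub>R (norm b *\<^sub>R a))"
      using False by (auto simp: field_simps)
    then show ?thesis using unit[of "b /\<^sub>R norm b" "norm b *\<^sub>R a"] False by simp
  qed
qed

lemma det_left_inverse: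
  fixes T S :: "real^'n \<Rightarrow> real^'n"
  assumes "linear T" "linear S" "\<And>x. S (T x) = x"
  shows "det (matrix S) * det (matrix T) = 1"
  using det_matrix_compose[OF assms(1,2)] assms(3) by (simp add: matrix_id[unfolded id_def])

text \<open>Both determinants are those of differentials of Gauss maps, extended by the normal as an
  eigenvector. On the hyperplane orthogonal to \<open>n\<close>, the extension of \<open>D'\<close> agrees modulo \<open>n\<close> with
  \<open>S A T\<^sup>-\<^sup>1 / |S \<nu>|\<close>, where \<open>A\<close> is the extension of \<open>D\<close>. Precomposing each of the two maps with a
  rank-one update of the identity makes them equal.\<close>

lemma det_normal_extension_transform:
  fixes T S T' D D' :: "real^'n \<Rightarrow> real^'n" and \<nu> :: "real^'n"
  assumes lin: "linear T" "linear T'" "linear S" "linear D" "linear D'"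
    and T': "\<And>x. T' (T x) = x" "\<And>x. T (T' x) = x"
    and S: "\<And>x y. S x \<bullet> T y = x \<bullet> y"
    and \<nu>: "norm \<nu> = 1"
    and n: "n = S \<nu> /\<^sub>R norm (S \<nu>)"
    and D': "\<And>w. w \<bullet> n = 0 \<Longrightarrow>
       D' w = (S (D (T' w)) - (S (D (T' w)) \<bullet> n) *\<^sub>R n) /\<^sub>R norm (S \<nu>)"
  shows "det (matrix (\<lambda>v. D' (v - (v \<bullet> n) *\<^sub>R n) + (v \<bullet> n) *\<^sub>R n)) * norm (S \<nu>) ^ (CARD('n) + 1) * (det (matrix T))\<^sup>2
     = det (matrix (\<lambda>v. D (v - (v \<bullet> \<nu>) *\<^sub>R \<nu>) + (v \<bullet> \<nu>) *\<^sub>R \<nu>))"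
proof -
  define s where "s = norm (S \<nu>)"
  define A where "A = (\<lambda>v. D (v - (v \<bullet> \<nu>) *\<^sub>R \<nu>) + (v \<bullet> \<nu>) *\<^sub>R \<nu>)"
  define A' where "A' = (\<lambda>v. D' (v - (v \<bullet> n) *\<^sub>R n) + (v \<bullet> n) *\<^sub>R n)"
  have \<nu>\<nu>: "\<nu> \<bullet> \<nu> = 1" using \<nu> by (simp add: dot_square_norm)
  have "S \<nu> \<noteq> 0" using S[of \<nu> \<nu>] \<nu>\<nu> by auto
  then have s: "s > 0" by (simp add: s_def)
  have S\<nu>: "S \<nu> = s *\<^sub>R n" using s by (simp add: n s_def)
  have nn: "n \<bullet> n = 1" using s unfolding n s_def by (simp add: dot_square_norm)
  have proj: "(v - (v \<bullet> n) *\<^sub>R n) \<bullet> n = 0" for v by (simp add: inner_diff_left nn)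
  have orth: "T' w \<bullet> \<nu> = 0" if "w \<bullet> n = 0" for w
    using S[of \<nu> "T' w"] that by (simp add: T' S\<nu> inner_commute)
  have lA: "linear A" unfolding A_def
    using lin(4) by (intro linearI) (auto simp: algebra_simps inner_add_left linear_add linear_diff linear_scale)
  have lA': "linear A'" unfolding A'_def
    using lin(5) by (intro linearI) (auto simp: algebra_simps inner_add_left linear_add linear_diff linear_scale)
  define m where "m = T \<nu>"
  define B where "B = (\<lambda>v. S (A (T' v)) /\<^sub>R s)"
  \<comment> \<open>\<open>M\<close> fixes the hyperplane orthogonal to \<open>n\<close> and sends
    \<open>n\<close> to \<open>m\<close>, which \<open>B\<close> sends back to
    \<open>n\<close>.\<close>
  define M where "M = (\<lambda>v. v + (v \<bullet> n) *\<^sub>R (m - n))"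
  \<comment> \<open>On that hyperplane \<open>B\<close> and \<open>A'\<close> differ by a multiple
    of \<open>n\<close>, whose coefficient is \<open>l\<close>. The map \<open>F\<close> adds this
    multiple before \<open>A'\<close>, which fixes \<open>n\<close>, is applied; so \<open>B\<close>
    after \<open>M\<close> equals \<open>A'\<close> after \<open>F\<close>.\<close>
  define l where "l = (\<lambda>v. B (v - (v \<bullet> n) *\<^sub>R n) \<bullet> n)"
  have lB: "linear B" unfolding B_def
    using linear_compose[OF linear_compose[OF lin(2) lA] lin(3)] by (intro linear_compose_scale_right) (simp add: o_def)
  have lM: "linear M" unfolding M_def by (intro linearI) (auto simp: algebra_simps inner_add_left)
  have ll: "linear l" unfolding l_def
    using lB by (intro linearI) (auto simp: algebra_simps inner_add_left inner_diff_left linear_add linear_diff linear_scale)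
  define b where "b = adjoint l 1"
  have b: "l v = v \<bullet> b" for v
    using adjoint_works[OF ll, of v 1] by (simp add: b_def)
  define F where "F = (\<lambda>v. v + (v \<bullet> b) *\<^sub>R n)"
  have lF: "linear F" unfolding F_def by (intro linearI) (auto simp: algebra_simps inner_add_left)
  have nb: "n \<bullet> b = 0"
    using b[of n] lB by (simp add: l_def nn linear_0)
  have A'n: "A' n = n" unfolding A'_def using lin(5) by (simp add: nn linear_0)
  have A\<nu>: "A \<nu> = \<nu>" unfolding A_def using lin(4) by (simp add: \<nu>\<nu> linear_0)
  have BM: "B (M v) = A' (F v)" for v
  proof -
    let ?w = "v - (v \<bullet> n) *\<^sub>R n"
    have "M v = ?w + (v \<bullet> n) *\<^sub>R m" by (simp add: M_def algebra_simps)
    moreover have "B m = n" using s by (simp add: B_def m_def T' A\<nu> S\<nu>)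
    ultimately have 1: "B (M v) = B ?w + (v \<bullet> n) *\<^sub>R n"
      using lB by (simp add: linear_add linear_scale)
    have w: "?w \<bullet> n = 0" by (rule proj)
    have Bw: "B ?w = S (D (T' ?w)) /\<^sub>R s"
      using orth[OF w] by (simp add: B_def A_def)
    have "A' v = D' ?w + (v \<bullet> n) *\<^sub>R n" by (simp add: A'_def)
    also have "D' ?w = B ?w - (B ?w \<bullet> n) *\<^sub>R n"
      using D'[OF w] unfolding Bw s_def[symmetric] by (simp add: algebra_simps)
    finally have "A' (F v) = B ?w - (B ?w \<bullet> n) *\<^sub>R n + (v \<bullet> n) *\<^sub>R n + (v \<bullet> b) *\<^sub>R n"
      using lA' A'n by (simp add: F_def linear_add linear_scale)
    also have "v \<bullet> b = B ?w \<bullet> n" using b[of v] by (simp add: l_def)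
    finally show ?thesis using 1 by simp
  qed
  have detM: "det (matrix M) = 1 / s"
  proof -
    have "s * (m \<bullet> n) = 1" using S[of \<nu> \<nu>] by (simp add: S\<nu> m_def \<nu>\<nu> inner_commute)
    then have "m \<bullet> n = 1 / s" using s by (simp add: field_simps)
    then show ?thesis unfolding M_def det_rank_one_update by (simp add: inner_diff_left nn)
  qed
  have detF: "det (matrix F) = 1"
    unfolding F_def det_rank_one_update by (simp add: nb)
  have "det (matrix S) * det (matrix T) = 1"
  proof -
    have "S x \<bullet> y = x \<bullet> T' y" for x y using S[of x "T' y"] by (simp add: T')
    then have "S = adjoint T'" by (intro adjoint_unique[symmetric]) (metis inner_commute)
    then have "det (matrix S) = det (matrix T')" using lin(2) by (simp add: matrix_adjoint)
    then show ?thesis using det_left_inverse[OF lin(1,2) T'(1)] by simp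
  qed
  moreover have "det (matrix T') * det (matrix T) = 1"
    by (rule det_left_inverse[OF lin(1,2) T'(1)])
  ultimately have dST: "det (matrix S) * det (matrix T') * (det (matrix T))\<^sup>2 = 1"
    by (simp add: power2_eq_square algebra_simps)
  have detB: "det (matrix B) * s ^ CARD('n) = det (matrix S) * det (matrix A) * det (matrix T')"
  proof -
    have "matrix (\<lambda>v. S (A (T' v))) = s *\<^sub>R matrix B"
      using s by (simp add: matrix_def B_def vec_eq_iff)
    then have "matrix (\<lambda>v. S (A (T' v))) = (\<chi> i. s *s matrix B $ i)"
      by (simp add: vec_eq_iff)
    then have "det (matrix (\<lambda>v. S (A (T' v)))) = s ^ CARD('n) * det (matrix B)"
      by (simp add: det_rows_mul vec_lambda_eta)
    then show ?thesis
      using det_matrix_compose[OF lin(2) linear_compose[OF lA lin(3)]] det_matrix_compose[OF lA lin(3)]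
      by (simp add: o_def mult.commute)
  qed
  have "det (matrix A') = det (matrix B) / s"
    using det_matrix_compose[OF lM lB] det_matrix_compose[OF lF lA'] detM detF BM by simp
  then have "det (matrix A') * s ^ (CARD('n) + 1) * (det (matrix T))\<^sup>2
      = det (matrix B) * s ^ CARD('n) * (det (matrix T))\<^sup>2" using s by simp
  also have "\<dots> = det (matrix A) * (det (matrix S) * det (matrix T') * (det (matrix T))\<^sup>2)"
    unfolding detB by (simp add: algebra_simps)
  finally show ?thesis unfolding dST A_def A'_def s_def by simp
qed

section \<open>The Gauss map of a convex body of class $C^2$\<close>

text \<open>The Bouligand contingent cone.\<close>

definition tangent_vector :: "'a::real_normed_vector set \<Rightarrow> 'a \<Rightarrow> 'a \<Rightarrow> bool" where
  "tangent_vector S x w \<longleftrightarrow>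
     (\<forall>c>0. \<forall>d>0. \<exists>\<epsilon> z. 0 < \<epsilon> \<and> \<epsilon> < d \<and> norm (z - w) \<le> c \<and> x + \<epsilon> *\<^sub>R z \<in> S)"

text \<open>The difference \<open>E\<close> of the two derivatives is a derivative of the zero
  function within \<open>S\<close>, so it is small at vectors \<open>z\<close> with
  \<open>x + \<epsilon> *\<^sub>R z\<close> in \<open>S\<close>. As \<open>z\<close> may be taken
  near \<open>w\<close>, continuity gives \<open>E w = 0\<close>. This pins down the derivative of
  the Gauss map on tangent vectors.\<close>

lemma has_derivative_unique_tangent:
  fixes f :: "'a::real_normed_vector \<Rightarrow> 'b::real_normed_vector"
  assumes D: "(f has_derivative D1) (at x within S)" "(f has_derivative D2) (at x within S)"
    and w: "tangent_vector S x w"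
  shows "D1 w = D2 w"
proof -
  define E where "E = (\<lambda>v. D1 v - D2 v)"
  have E0: "((\<lambda>_. 0) has_derivative E) (at x within S)"
    using has_derivative_diff[OF D] by (simp add: E_def)
  then have bl: "bounded_linear E" by (rule has_derivative_bounded_linear)
  then obtain B where B: "\<And>v. norm (E v) \<le> norm v * B" and B0: "B > 0"
    using bounded_linear.pos_bounded by blast
  interpret E: bounded_linear E by (rule bl)
  have bound: "norm (E w) \<le> c * (norm w + 1 + B)" if c: "0 < c" "c \<le> 1" for c
  proof -
    obtain d where d: "d > 0" and
      le: "\<And>y. y \<in> S \<Longrightarrow> norm (y - x) < d \<Longrightarrow> norm (E (y - x)) \<le> c * norm (y - x)"
      using E0 c(1) unfolding has_derivative_within_alt by (auto simp: dist_norm)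
    \<comment> \<open>The bound on \<epsilon> ensures
      \<open>norm (\<epsilon> *\<^sub>R z) < d\<close>, since
      \<open>norm z \<le> norm w + 1\<close>.\<close>
    obtain \<epsilon> z where \<epsilon>: "0 < \<epsilon>" "\<epsilon> < d / (norm w + 1)" and z: "norm (z - w) \<le> c"
      and S: "x + \<epsilon> *\<^sub>R z \<in> S"
      using w c(1) d unfolding tangent_vector_def
      by (metis add_nonneg_pos divide_pos_pos norm_ge_zero zero_less_one)
    have nz: "norm z \<le> norm w + 1"
      using z c(2) norm_triangle_ineq2[of z w] by linarith
    have "\<epsilon> * norm z \<le> \<epsilon> * (norm w + 1)" using nz \<epsilon>(1) by simp
    also have "\<dots> < d" using \<epsilon>(2) by (simp add: pos_less_divide_eq add_nonneg_pos)
    finally have "norm (E (\<epsilon> *\<^sub>R z)) \<le> c * norm (\<epsilon> *\<^sub>R z)"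
      using le[OF S] \<epsilon>(1) by simp
    then have "norm (E z) \<le> c * norm z"
      using \<epsilon>(1) by (simp add: E.scaleR)
    also have "\<dots> \<le> c * (norm w + 1)" using nz c by simp
    finally have 1: "norm (E z) \<le> c * (norm w + 1)" .
    have "norm (E (z - w)) \<le> c * B"
      using B[of "z - w"] z B0 by (meson mult_right_mono less_imp_le order_trans)
    moreover have "norm (E w) \<le> norm (E z) + norm (E (z - w))"
      using norm_triangle_ineq4[of "E z" "E (z - w)"] by (simp add: E.diff)
    ultimately show ?thesis using 1 by (simp add: algebra_simps)
  qed
  have "norm (E w) \<le> 0"
  proof (rule field_le_epsilon)
    fix e :: real assume e: "e > 0"
    let ?M = "norm w + 1 + B"
    have M: "?M > 0" using B0 by (simp add: add_nonneg_pos add_pos_pos)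
    have "norm (E w) \<le> min 1 (e / ?M) * ?M"
      by (rule bound) (use e M in auto)
    also have "\<dots> \<le> (e / ?M) * ?M" using M by (intro mult_right_mono) auto
    finally show "norm (E w) \<le> 0 + e" using M by simp
  qed
  then show ?thesis by (simp add: E_def)
qed

text \<open>The intermediate value theorem replaces the implicit function theorem: moving
  from \<open>x + \<epsilon> w\<close> in the directions \<open>\<plusminus>c G\<close> makes \<open>g\<close> change its sign.\<close>

lemma tangent_vector_level_set:
  fixes g :: "'a::real_inner \<Rightarrow> real"
  assumes U: "open U" "x \<in> U" and g: "(g has_derivative (\<lambda>v. G \<bullet> v)) (at x)"
    and cont: "continuous_on U g" and gx: "g x = 0" and G: "G \<noteq> 0" and w: "G \<bullet> w = 0"
    and S: "\<And>y. y \<in> U \<Longrightarrow> g y = 0 \<Longrightarrow> y \<in> S"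
  shows "tangent_vector S x w"
  unfolding tangent_vector_def
proof (intro allI impI)
  fix c0 d :: real assume c0: "c0 > 0" and d: "d > 0"
  define c where "c = c0 / norm G"
  have c: "c > 0" using c0 G by (simp add: c_def)
  \<comment> \<open>\<open>M\<close> bounds \<open>norm (w + t *\<^sub>R G)\<close> for
    \<open>\<bar>t\<bar> \<le> c\<close>.\<close>
  define M where "M = norm w + c * norm G + 1"
  have M: "M > 0" using c by (simp add: M_def add_nonneg_pos)
  obtain r where r: "r > 0" "ball x r \<subseteq> U" using U by (meson openE)
  \<comment> \<open>With this \<eta> the linearisation error is at most half of
    \<open>\<epsilon> * c * (G \<bullet> G)\<close>, the size of the linear part at
    \<open>t = c\<close> and \<open>t = -c\<close>, so \<open>g\<close> has the sign of the linear
    part there.\<close>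
  define \<eta> where "\<eta> = c * (G \<bullet> G) / (2 * M)"
  have GG: "G \<bullet> G > 0" using G by simp
  have \<eta>: "\<eta> > 0" using c GG M by (simp add: \<eta>_def)
  obtain \<delta> where \<delta>: "\<delta> > 0" and
    le: "\<And>y. norm (y - x) < \<delta> \<Longrightarrow> norm (g y - g x - G \<bullet> (y - x)) \<le> \<eta> * norm (y - x)"
    using g \<eta> unfolding has_derivative_at_alt by blast
  define \<epsilon> where "\<epsilon> = min (d / 2) (min (r / (2 * M)) (\<delta> / (2 * M)))"
  have \<epsilon>: "0 < \<epsilon>" "\<epsilon> < d" "\<epsilon> * M < r" "\<epsilon> * M < \<delta>"
  proof -
    show "0 < \<epsilon>" "\<epsilon> < d" using d r M \<delta> by (auto simp: \<epsilon>_def min_less_iff_disj)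
    have "\<epsilon> \<le> r / (2 * M)" "\<epsilon> \<le> \<delta> / (2 * M)" by (simp_all add: \<epsilon>_def)
    then have "\<epsilon> * M \<le> r / (2 * M) * M" "\<epsilon> * M \<le> \<delta> / (2 * M) * M"
      using M by (intro mult_right_mono; simp)+
    then have "\<epsilon> * M \<le> r / 2" "\<epsilon> * M \<le> \<delta> / 2" using M by auto
    then show "\<epsilon> * M < r" "\<epsilon> * M < \<delta>" using r \<delta> by auto
  qed
  define P where "P = (\<lambda>t. x + \<epsilon> *\<^sub>R (w + t *\<^sub>R G))"
  have nrm: "norm (w + t *\<^sub>R G) \<le> M" if "\<bar>t\<bar> \<le> c" for t
  proof -
    have "norm (w + t *\<^sub>R G) \<le> norm w + \<bar>t\<bar> * norm G" using norm_triangle_ineq[of w "t *\<^sub>R G"] by simp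
    also have "\<bar>t\<bar> * norm G \<le> c * norm G" using that by (intro mult_right_mono) auto
    finally show ?thesis by (simp add: M_def)
  qed
  have nP: "norm (P t - x) \<le> \<epsilon> * M" if "\<bar>t\<bar> \<le> c" for t
    using mult_left_mono[OF nrm[OF that], of \<epsilon>] \<epsilon>(1) by (simp add: P_def)
  have PU: "P t \<in> U" if "\<bar>t\<bar> \<le> c" for t
    using nP[OF that] \<epsilon>(3) r(2) by (auto simp: dist_norm norm_minus_commute subset_iff)
  have est: "\<bar>g (P t) - \<epsilon> * t * (G \<bullet> G)\<bar> \<le> \<epsilon> * c * (G \<bullet> G) / 2" if t: "\<bar>t\<bar> \<le> c" for t
  proof -
    have "norm (g (P t) - g x - G \<bullet> (P t - x)) \<le> \<eta> * norm (P t - x)"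
      using le nP[OF t] \<epsilon>(4) by auto
    also have "\<dots> \<le> \<eta> * (\<epsilon> * M)" using \<eta> nP[OF t] by (intro mult_left_mono) auto
    also have "\<dots> = \<epsilon> * c * (G \<bullet> G) / 2" using M by (simp add: \<eta>_def)
    also have "G \<bullet> (P t - x) = \<epsilon> * t * (G \<bullet> G)" by (simp add: P_def inner_add_right w)
    finally show ?thesis by (simp add: gx)
  qed
  have pos: "\<epsilon> * c * (G \<bullet> G) > 0" using \<epsilon>(1) c GG by simp
  have "continuous_on {-c..c} (\<lambda>t. g (P t))"
  proof (rule continuous_on_compose2[OF cont])
    show "continuous_on {-c..c} P" unfolding P_def by (intro continuous_intros)
    show "P ` {-c..c} \<subseteq> U" using PU by (auto simp: abs_le_iff)
  qed
  moreover have "g (P (-c)) \<le> 0" "0 \<le> g (P c)"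
    using est[of "-c"] est[of c] c pos unfolding abs_le_iff by simp_all
  ultimately obtain t where t: "-c \<le> t" "t \<le> c" "g (P t) = 0"
    using IVT'[of "\<lambda>t. g (P t)" "-c" 0 c] c by auto
  then have "\<bar>t\<bar> \<le> c" by auto
  moreover from this have "norm (w + t *\<^sub>R G - w) \<le> c0"
    using G mult_right_mono[of "\<bar>t\<bar>" c "norm G"] by (simp add: c_def)
  moreover have "P t \<in> S" using S PU t(3) \<open>\<bar>t\<bar> \<le> c\<close> by blast
  ultimately show "\<exists>\<epsilon> z. 0 < \<epsilon> \<and> \<epsilon> < d \<and> norm (z - w) \<le> c0 \<and> x + \<epsilon> *\<^sub>R z \<in> S"
    using \<epsilon>(1,2) unfolding P_def by blast
qed

text \<open>Points \<open>x + \<epsilon> *\<^sub>R z\<close> of \<open>S\<close> give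
  \<open>z \<bullet> u \<le> 0\<close> for \<open>z\<close> as close to \<open>w\<close> as
  desired.\<close>

lemma tangent_vector_supporting:
  fixes u :: "'a::real_inner"
  assumes w: "tangent_vector S x w" and u: "\<And>y. y \<in> S \<Longrightarrow> y \<bullet> u \<le> x \<bullet> u"
  shows "w \<bullet> u \<le> 0"
proof (rule field_le_epsilon)
  fix e :: real assume e: "e > 0"
  define c where "c = e / (norm u + 1)"
  have c: "c > 0" unfolding c_def using e by (simp add: add_nonneg_pos)
  obtain \<epsilon> z where \<epsilon>: "0 < \<epsilon>" "\<epsilon> < 1" and z: "norm (z - w) \<le> c" and S: "x + \<epsilon> *\<^sub>R z \<in> S"
    using w c unfolding tangent_vector_def by (meson zero_less_one)
  have "z \<bullet> u \<le> 0" using u[OF S] \<epsilon>(1) by (simp add: inner_add_left mult_le_0_iff)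
  moreover have "(w - z) \<bullet> u \<le> norm (w - z) * norm u" by (rule norm_cauchy_schwarz)
  moreover have "norm (w - z) * norm u \<le> c * norm u"
    using z by (intro mult_right_mono) (auto simp: norm_minus_commute)
  moreover have "c * norm u \<le> e" using e unfolding c_def
    by (simp add: divide_simps add_nonneg_pos)
  ultimately show "w \<bullet> u \<le> 0 + e" by (simp add: inner_diff_left)
qed

text \<open>This is the source of the projection and of the division by
  \<open>norm (S \<nu>)\<close> in \<open>det_normal_extension_transform\<close>.\<close>

lemma has_derivative_normalize:
  fixes z :: "'a::real_inner"
  assumes "z \<noteq> 0"
  shows "((\<lambda>y. y /\<^sub>R norm y) has_derivative
           (\<lambda>w. (w - (w \<bullet> (z /\<^sub>R norm z)) *\<^sub>R (z /\<^sub>R norm z)) /\<^sub>R norm z)) (at z within S)"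
proof -
  have "(norm has_derivative (\<lambda>x. inverse (norm z) * (x \<bullet> z))) (at z within S)"
    using has_derivative_at_withinI[OF has_derivative_norm[OF assms]]
    by (simp add: sgn_div_norm inner_commute)
  then show ?thesis using assms
    by (auto intro!: derivative_eq_intros
      simp: fun_eq_iff algebra_simps sgn_div_norm inner_commute power2_eq_square)
qed


section \<open>Outer unit normals and differentiability of the Gauss map\<close>

lemma frontier_convex_body:
  fixes K :: "(real^'n) set"
  assumes "convex_body K"
  shows "closed K" "frontier K \<subseteq> K"
  using assms unfolding convex_body_def by (auto simp: compact_imp_closed frontier_subset_closed)

text \<open>A ball around \<open>c\<close> lies in \<open>K\<close>, hence below the supporting
  hyperplane. The strict inequality later selects the outward one of two opposite unit
  normals.\<close>

lemma outer_unit_normal_interior: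
  fixes K :: "(real^'n) set"
  assumes u: "outer_unit_normal K x u" and c: "c \<in> interior K"
  shows "(x - c) \<bullet> u > 0"
proof -
  obtain r where r: "r > 0" "cball c r \<subseteq> K"
    using c mem_interior_cball by blast
  have nu: "norm u = 1" using u by (simp add: outer_unit_normal_def)
  then have "c + r *\<^sub>R u \<in> K" using r by (auto simp: subset_iff dist_norm)
  then have "(c + r *\<^sub>R u) \<bullet> u \<le> x \<bullet> u" using u by (simp add: outer_unit_normal_def)
  then show ?thesis using r(1) nu
    by (simp add: inner_add_left inner_diff_left dot_square_norm)
qed

lemma outer_unit_normal_exists:
  fixes K :: "(real^'n) set"
  assumes K: "convex_body K" and x: "x \<in> frontier K"
  shows "\<exists>u. outer_unit_normal K x u"
proof -
  have cl: "closed K" and fr: "frontier K \<subseteq> K" using frontier_convex_body[OF K] by auto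
  have "x \<notin> interior K" using x cl by (simp add: frontier_def)
  then have "x \<notin> rel_interior K"
    using K by (simp add: convex_body_def rel_interior_nonempty_interior)
  moreover have "convex K" "x \<in> K" using K x fr by (auto simp: convex_body_def)
  ultimately obtain a where a: "a \<noteq> 0" "\<And>y. y \<in> K \<Longrightarrow> a \<bullet> x \<le> a \<bullet> y"
    using supporting_hyperplane_rel_boundary[of K x] by metis
  have "outer_unit_normal K x (- a /\<^sub>R norm a)"
    using a x unfolding outer_unit_normal_def
    by (auto simp: inner_commute intro!: mult_left_mono)
  then show ?thesis by blast
qed

text \<open>The supporting inequality holds for a tangent vector and for its negative, so
  \<open>u\<close> is a multiple of \<open>G\<close>; the interior point \<open>c\<close> fixes the
  sign.\<close>

lemma outer_unit_normal_eq_gradient: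
  fixes K :: "(real^'n) set"
  assumes u: "outer_unit_normal K x u" and c: "c \<in> interior K" and sub: "frontier K \<subseteq> K"
    and G: "G \<noteq> 0" and tan: "\<And>w. G \<bullet> w = 0 \<Longrightarrow> tangent_vector (frontier K) x w"
  shows "u = sgn ((x - c) \<bullet> G) *\<^sub>R (G /\<^sub>R norm G)"
proof -
  \<comment> \<open>\<open>k *\<^sub>R G\<close> is the orthogonal projection of \<open>u\<close> to
    the line of \<open>G\<close>; the remainder \<open>?w\<close> is tangent and will
    vanish.\<close>
  define k where "k = (u \<bullet> G) / (G \<bullet> G)"
  let ?w = "u - k *\<^sub>R G"
  have le: "w \<bullet> u \<le> 0" if "G \<bullet> w = 0" for w
    using tangent_vector_supporting[OF tan[OF that], of u] u sub
    by (auto simp: outer_unit_normal_def)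
  have Gw: "G \<bullet> ?w = 0" using G by (simp add: k_def inner_diff_right inner_commute)
  then have "G \<bullet> (- ?w) = 0" by (simp only: inner_minus_right)
  from le[OF this] have "?w \<bullet> u = 0" using le[OF Gw] by (simp only: inner_minus_left)
  then have "?w \<bullet> ?w = 0" using Gw by (simp add: inner_diff_right inner_commute)
  then have uk: "u = k *\<^sub>R G" by simp
  have nk: "\<bar>k\<bar> * norm G = 1" using u unfolding uk outer_unit_normal_def by simp
  have "k * ((x - c) \<bullet> G) > 0" using outer_unit_normal_interior[OF u c] by (simp add: uk)
  then have "sgn k = sgn ((x - c) \<bullet> G)" by (auto simp: zero_less_mult_iff)
  moreover have "k = sgn k * inverse (norm G)"
    using nk G by (auto simp: field_simps sgn_if abs_if split: if_splits)
  ultimately show ?thesis unfolding uk by simp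
qed

text \<open>The field \<open>G\<close> is the gradient of a local defining function: second-order
  smoothness makes it differentiable and regularity makes it nonzero.\<close>

lemma C2_hypersurface_normal_field:
  fixes S :: "(real^'n) set"
  assumes "C2_hypersurface S" "x \<in> S"
  obtains U G H where "open U" "x \<in> U" "(G has_derivative H) (at x)"
    "\<And>y. y \<in> S \<Longrightarrow> y \<in> U \<Longrightarrow> G y \<noteq> 0"
    "\<And>y w. y \<in> S \<Longrightarrow> y \<in> U \<Longrightarrow> G y \<bullet> w = 0 \<Longrightarrow> tangent_vector S y w"
proof -
  obtain U g where U: "open U" "x \<in> U" and g: "C2_on U g" and SU: "S \<inter> U = {y \<in> U. g y = 0}"
    and reg: "\<forall>y\<in>U. \<not> (g has_derivative (\<lambda>v. 0)) (at y)"
    using assms unfolding C2_hypersurface_def by blast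
  obtain G H where G: "\<And>y. y \<in> U \<Longrightarrow> (g has_derivative (\<lambda>v. G y \<bullet> v)) (at y)"
    and H: "\<And>y. y \<in> U \<Longrightarrow> (G has_derivative (\<lambda>v. H y *v v)) (at y)"
    using g unfolding C2_on_def by blast
  have G0: "G y \<noteq> 0" if "y \<in> U" for y
    using G[OF that] bspec[OF reg that] by auto
  have cont: "continuous_on U g"
    using G by (meson continuous_at_imp_continuous_on has_derivative_continuous)
  show thesis
  proof (rule that[OF U H[OF U(2)]])
    show "G y \<noteq> 0" if "y \<in> S" "y \<in> U" for y using G0 that by blast
    show "tangent_vector S y w" if "y \<in> S" "y \<in> U" "G y \<bullet> w = 0" for y w
      by (rule tangent_vector_level_set[OF U(1) \<open>y \<in> U\<close> G[OF \<open>y \<in> U\<close>] cont _ G0[OF \<open>y \<in> U\<close>]])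
        (use that SU in auto)
  qed
qed

text \<open>Near \<open>x\<close> the Gauss map is the normalized gradient of a defining function,
  oriented away from an interior point \<open>c\<close>. The orienting sign is locally constant, so
  the Gauss map inherits differentiability from the gradient.\<close>

lemma gauss_map_properties:
  fixes K :: "(real^'n) set"
  assumes K: "convex_body K" and C2: "C2_hypersurface (frontier K)" and x: "x \<in> frontier K"
  shows outer_unit_normal_iff_gauss_map: "\<And>u. outer_unit_normal K x u \<longleftrightarrow> u = gauss_map K x"
    and gauss_map_differentiable: "gauss_map K differentiable (at x within frontier K)"
    and tangent_vector_frontier: "\<And>w. w \<bullet> gauss_map K x = 0 \<Longrightarrow> tangent_vector (frontier K) x w"
proof -
  obtain c where c: "c \<in> interior K" using K by (auto simp: convex_body_def)
  note sub = frontier_convex_body(2)[OF K]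
  obtain U G H where U: "open U" "x \<in> U" and H: "(G has_derivative H) (at x)"
    and G0: "\<And>y. y \<in> frontier K \<Longrightarrow> y \<in> U \<Longrightarrow> G y \<noteq> 0"
    and tan: "\<And>y w. y \<in> frontier K \<Longrightarrow> y \<in> U \<Longrightarrow> G y \<bullet> w = 0 \<Longrightarrow> tangent_vector (frontier K) y w"
    using C2_hypersurface_normal_field[OF C2 x] by metis
  define N where "N = (\<lambda>y. sgn ((y - c) \<bullet> G y) *\<^sub>R (G y /\<^sub>R norm (G y)))"
  have N: "u = N y" if "y \<in> frontier K" "y \<in> U" "outer_unit_normal K y u" for y u
    unfolding N_def using outer_unit_normal_eq_gradient[OF that(3) c sub G0 tan] that by blast
  have gm: "gauss_map K y = N y \<and> outer_unit_normal K y (N y)" if y: "y \<in> frontier K" "y \<in> U" for y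
  proof -
    obtain u where u: "outer_unit_normal K y u" using outer_unit_normal_exists[OF K y(1)] by blast
    with N[OF y] have "outer_unit_normal K y (N y)" by blast
    moreover have "gauss_map K y = N y" unfolding gauss_map_def
      by (rule the_equality) (use calculation N[OF y] in blast)+
    ultimately show ?thesis by blast
  qed
  show "outer_unit_normal K x u \<longleftrightarrow> u = gauss_map K x" for u
    using gm[OF x U(2)] N[OF x U(2)] by metis
  have sx: "(x - c) \<bullet> N x > 0"
    by (rule outer_unit_normal_interior[OF conjunct2[OF gm[OF x U(2)]] c])
  then have s0: "(x - c) \<bullet> G x \<noteq> 0" unfolding N_def by auto
  show "tangent_vector (frontier K) x w" if "w \<bullet> gauss_map K x = 0" for w
  proof (rule tan[OF x U(2)])
    show "G x \<bullet> w = 0"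
      using that gm[OF x U(2)] s0 G0[OF x U(2)] by (auto simp: N_def inner_commute sgn_0_0)
  qed
  have "isCont (\<lambda>y. (y - c) \<bullet> G y) x"
    using has_derivative_continuous[OF H] by (intro continuous_intros) auto
  then have "((\<lambda>y. (y - c) \<bullet> G y) \<longlongrightarrow> (x - c) \<bullet> G x) (at x)" by (simp add: isCont_def)
  then have "\<forall>\<^sub>F y in at x. sgn ((y - c) \<bullet> G y) = sgn ((x - c) \<bullet> G x)"
  proof (cases "(x - c) \<bullet> G x > 0")
    case True
    with order_tendstoD(1)[OF \<open>(_ \<longlongrightarrow> _) (at x)\<close> this] show ?thesis
      by (auto elim!: eventually_mono)
  next
    case False
    with s0 have "(x - c) \<bullet> G x < 0" by simp
    with order_tendstoD(2)[OF \<open>(_ \<longlongrightarrow> _) (at x)\<close> this] show ?thesis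
      by (auto elim!: eventually_mono)
  qed
  then have sg: "\<forall>\<^sub>F y in at x within frontier K. sgn ((y - c) \<bullet> G y) = sgn ((x - c) \<bullet> G x)"
    by (rule filter_leD[OF at_le[OF subset_UNIV]])
  have inU: "\<forall>\<^sub>F y in at x within frontier K. y \<in> U"
    using eventually_nhds_in_open[OF U] by (auto simp: eventually_at_filter elim: eventually_mono)
  have inF: "\<forall>\<^sub>F y in at x within frontier K. y \<in> frontier K"
    by (simp add: eventually_at_filter)
  \<comment> \<open>\<open>F\<close> freezes the sign at its value in \<open>x\<close>. It is
    therefore differentiable at \<open>x\<close>, and it agrees with the Gauss map on the frontier
    near \<open>x\<close>.\<close>
  define F where "F = (\<lambda>y. sgn ((x - c) \<bullet> G x) *\<^sub>R (G y /\<^sub>R norm (G y)))"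
  obtain F' where F': "(F has_derivative F') (at x within frontier K)"
  proof -
    have "((\<lambda>y. y /\<^sub>R norm y) \<circ> G) differentiable (at x)"
      using diff_chain_at[OF H has_derivative_normalize[OF G0[OF x U(2)]]]
      by (rule differentiableI)
    then have "F differentiable (at x)"
      unfolding F_def o_def by (rule differentiable_scaleR[OF differentiable_const])
    then have "F differentiable (at x within frontier K)" by (rule differentiable_at_withinI)
    then show thesis using that by (auto simp: differentiable_def)
  qed
  have "(gauss_map K has_derivative F') (at x within frontier K)"
  proof (rule has_derivative_transform_eventually[OF F'])
    show "\<forall>\<^sub>F y in at x within frontier K. F y = gauss_map K y"
      using sg inU inF by eventually_elim (simp add: F_def gm N_def)
    show "F x = gauss_map K x" using gm[OF x U(2)] by (simp add: F_def N_def)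
  qed (rule x)
  then show "gauss_map K differentiable (at x within frontier K)" by (rule differentiableI)
qed

section \<open>The boundary point with a given normal\<close>

lemma outer_unit_normal_I:
  fixes K :: "(real^'n) set"
  assumes K: "convex_body K" and x: "x \<in> K" and u: "norm u = 1" "\<And>y. y \<in> K \<Longrightarrow> y \<bullet> u \<le> x \<bullet> u"
  shows "outer_unit_normal K x u"
proof -
  have "x \<notin> interior K"
  proof
    assume "x \<in> interior K"
    then obtain r where r: "r > 0" "cball x r \<subseteq> K" using mem_interior_cball by blast
    then have "x + r *\<^sub>R u \<in> K" using u(1) by (auto simp: subset_iff dist_norm)
    from u(2)[OF this] show False using r(1) u(1) by (simp add: inner_add_left dot_square_norm)
  qed
  then have "x \<in> frontier K" using x frontier_convex_body(1)[OF K] by (simp add: frontier_def closure_closed)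
  then show ?thesis using u by (simp add: outer_unit_normal_def)
qed

lemma outer_unit_normal_point_exists:
  fixes K :: "(real^'n) set"
  assumes K: "convex_body K" and u: "norm u = 1"
  shows "\<exists>x. outer_unit_normal K x u"
proof -
  have "compact K" "K \<noteq> {}" using K by (auto simp: convex_body_def)
  moreover have "continuous_on K (\<lambda>x. x \<bullet> u)" by (intro continuous_intros)
  ultimately obtain x where "x \<in> K" "\<And>y. y \<in> K \<Longrightarrow> y \<bullet> u \<le> x \<bullet> u"
    using continuous_attains_sup by metis
  then show ?thesis using outer_unit_normal_I[OF K _ u] by blast
qed

lemma gauss_map_has_derivative:
  fixes K :: "(real^'n) set"
  assumes "convex_body K" "C2_plus K" "x \<in> frontier K"
  shows "(gauss_map K has_derivative frechet_derivative (gauss_map K) (at x within frontier K))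
           (at x within frontier K)"
  using gauss_map_differentiable[of K x] assms by (simp add: C2_plus_def frechet_derivative_works)

text \<open>Strict convexity: along a segment in the boundary the Gauss map is constant, so its differential is
  singular.\<close>

lemma outer_unit_normal_point_unique:
  fixes K :: "(real^'n) set"
  assumes K: "convex_body K" and C2: "C2_plus K"
    and x: "outer_unit_normal K x u" and y: "outer_unit_normal K y u"
  shows "x = y"
proof (rule ccontr)
  assume "x \<noteq> y"
  define w where "w = y - x"
  have w0: "w \<noteq> 0" using \<open>x \<noteq> y\<close> by (simp add: w_def)
  have C2': "C2_hypersurface (frontier K)" using C2 by (simp add: C2_plus_def)
  have xK: "x \<in> K" "y \<in> K" and xf: "x \<in> frontier K" and u: "norm u = 1"
    using x y frontier_convex_body(2)[OF K] by (auto simp: outer_unit_normal_def)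
  have "x \<bullet> u = y \<bullet> u" using x y xK by (intro antisym) (auto simp: outer_unit_normal_def)
  then have wu: "w \<bullet> u = 0" by (simp add: w_def inner_diff_left)
  \<comment> \<open>The segment from \<open>x\<close> to \<open>y\<close>; all of its points have
    the normal \<open>u\<close>.\<close>
  define S where "S = (\<lambda>t. x + t *\<^sub>R w) ` {0..1}"
  have seg: "outer_unit_normal K z u" if zS: "z \<in> S" for z
  proof -
    obtain t where t: "t \<in> {0..1}" "z = x + t *\<^sub>R w" using zS unfolding S_def by blast
    have "z = (1 - t) *\<^sub>R x + t *\<^sub>R y" by (simp add: t w_def algebra_simps)
    moreover have "convex K" using K by (simp add: convex_body_def)
    ultimately have "z \<in> K" using xK t(1) by (simp add: convexD)
    moreover have "z \<bullet> u = x \<bullet> u" by (simp add: t inner_add_left wu)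
    ultimately show ?thesis
      using x by (intro outer_unit_normal_I[OF K _ u]) (auto simp: outer_unit_normal_def)
  qed
  have const: "gauss_map K z = u" if "z \<in> S" for z
    using outer_unit_normal_iff_gauss_map[OF K C2', of z u] seg[OF that]
    by (auto simp: outer_unit_normal_def)
  let ?D = "frechet_derivative (gauss_map K) (at x within frontier K)"
  have xS: "x \<in> S" unfolding S_def by (rule image_eqI[of _ _ 0]) auto
  have D: "(gauss_map K has_derivative ?D) (at x within frontier K)"
    by (rule gauss_map_has_derivative[OF K C2 xf])
  have "S \<subseteq> frontier K" using seg by (auto simp: outer_unit_normal_def)
  with D have D1: "(gauss_map K has_derivative ?D) (at x within S)" by (rule has_derivative_subset)
  have D2: "(gauss_map K has_derivative (\<lambda>_. 0)) (at x within S)"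
    by (rule has_derivative_transform[OF xS _ has_derivative_const]) (rule const)
  have "tangent_vector S x w"
    unfolding tangent_vector_def
  proof (intro allI impI)
    fix c d :: real assume "c > 0" "d > 0"
    then show "\<exists>\<epsilon> z. 0 < \<epsilon> \<and> \<epsilon> < d \<and> norm (z - w) \<le> c \<and> x + \<epsilon> *\<^sub>R z \<in> S"
      by (intro exI[of _ "min (d/2) 1"] exI[of _ w]) (auto simp: S_def)
  qed
  from has_derivative_unique_tangent[OF D1 D2 this] have Dw: "?D w = 0" .
  \<comment> \<open>The determinant of \<open>?A\<close> is the Gauss curvature at \<open>x\<close>.
    It vanishes, since \<open>w\<close> is nonzero, orthogonal to \<open>u\<close> and annihilated
    by \<open>?D\<close>.\<close>
  let ?A = "\<lambda>v. ?D (v - (v \<bullet> u) *\<^sub>R u) + (v \<bullet> u) *\<^sub>R u"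
  have lD: "linear ?D" using D by (rule has_derivative_linear)
  have lA: "linear ?A"
    using lD by (intro linearI) (auto simp: algebra_simps inner_add_left linear_add linear_diff linear_scale)
  have "?A w = ?A 0" using Dw wu lD by (simp add: linear_0)
  then have "\<not> inj ?A" using w0 injD[of ?A w 0] by blast
  then have "det (matrix ?A) = 0" using det_nz_iff_inj[OF lA] by blast
  moreover have "gauss_curvature K x > 0" using C2 xf by (simp add: C2_plus_def)
  ultimately show False by (simp add: gauss_curvature_def const[OF xS])
qed

lemma curvature_function_eq:
  fixes K :: "(real^'n) set"
  assumes "convex_body K" "C2_plus K" "outer_unit_normal K x u"
  shows "curvature_function K u = 1 / gauss_curvature K x"
proof -
  have "(THE x. outer_unit_normal K x u) = x"
    by (rule the_equality, rule assms(3), rule outer_unit_normal_point_unique[OF assms(1,2) _ assms(3)])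
  then show ?thesis by (simp add: curvature_function_def)
qed

lemma support_function_eq:
  fixes K :: "(real^'n) set"
  assumes "convex_body K" "outer_unit_normal K x u"
  shows "support_function K u = x \<bullet> u"
  unfolding support_function_def
  using assms frontier_convex_body(2)[OF assms(1)]
  by (intro cSup_eq_maximum) (auto simp: outer_unit_normal_def)

lemma tangent_vector_linear_image:
  fixes T :: "'a::euclidean_space \<Rightarrow> 'b::euclidean_space"
  assumes T: "linear T" and w: "tangent_vector S x w"
  shows "tangent_vector (T ` S) (T x) (T w)"
  unfolding tangent_vector_def
proof (intro allI impI)
  fix c d :: real assume c: "c > 0" and d: "d > 0"
  obtain B where B: "B > 0" "\<And>v. norm (T v) \<le> B * norm v"
    using linear_bounded_pos[OF T] by blast
  obtain \<epsilon> z where \<epsilon>: "0 < \<epsilon>" "\<epsilon> < d" "norm (z - w) \<le> c / B" "x + \<epsilon> *\<^sub>R z \<in> S"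
    using w c d B(1) unfolding tangent_vector_def by (meson divide_pos_pos)
  have "norm (T z - T w) \<le> B * norm (z - w)" using B(2)[of "z - w"] T by (simp add: linear_diff)
  also have "\<dots> \<le> c" using \<epsilon>(3) B(1) by (simp add: pos_le_divide_eq mult.commute)
  finally have "norm (T z - T w) \<le> c" .
  moreover have "T x + \<epsilon> *\<^sub>R T z \<in> T ` S"
    using \<epsilon>(4) T by (force simp: linear_add linear_scale)
  ultimately show "\<exists>\<epsilon> z. 0 < \<epsilon> \<and> \<epsilon> < d \<and> norm (z - T w) \<le> c \<and> T x + \<epsilon> *\<^sub>R z \<in> T ` S"
    using \<epsilon>(1,2) by blast
qed

section \<open>Linear images of convex bodies\<close>

context
  fixes T :: "real^'n \<Rightarrow> real^'n"
  assumes linT: "linear T" and bijT: "bij T"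
begin

lemma
  shows inv_T_T: "inv T (T x) = x" and T_inv_T: "T (inv T x) = x"
  using bijT by (auto simp: bij_is_inj bij_is_surj surj_f_inv_f)

lemma linear_inv_T: "linear (inv T)"
  using linear_inj_imp_surj linT bijT by (metis bij_is_inj inj_linear_imp_inv_linear)

text \<open>Normal directions transform under \<open>T\<close> by \<open>adjoint (inv T)\<close>;
  this is the property of \<open>S\<close> assumed in
  \<open>det_normal_extension_transform\<close>.\<close>

lemma adjoint_inv_T: "adjoint (inv T) x \<bullet> T y = x \<bullet> y"
  using adjoint_works[OF linear_inv_T, of "T y" x] by (simp add: inv_T_T inner_commute)

lemma adjoint_inv_adjoint: "adjoint (inv T) (adjoint T u) = u"
  and adjoint_adjoint_inv: "adjoint T (adjoint (inv T) u) = u"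
proof -
  have "x \<bullet> adjoint (inv T) (adjoint T u) = x \<bullet> u" for x
    by (simp add: adjoint_works linear_inv_T linT T_inv_T)
  then show "adjoint (inv T) (adjoint T u) = u" by (metis vector_eq_ldot)
  have "x \<bullet> adjoint T (adjoint (inv T) u) = x \<bullet> u" for x
    by (simp add: adjoint_works linear_inv_T linT inv_T_T)
  then show "adjoint T (adjoint (inv T) u) = u" by (metis vector_eq_ldot)
qed

lemma adjoint_T_nonzero: "norm u = 1 \<Longrightarrow> adjoint T u \<noteq> 0"
  using adjoint_inv_adjoint[of u] linear_0[OF adjoint_linear[OF linear_inv_T]] by auto

lemma frontier_linear_image: "frontier (T ` K) = T ` frontier K"
  using linT bij_is_inj[OF bijT]
  by (simp add: frontier_def closure_injective_linear_image interior_injective_linear_image image_set_diff)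

lemma convex_body_linear_image: "convex_body K \<Longrightarrow> convex_body (T ` K)"
  using linT bij_is_inj[OF bijT] unfolding convex_body_def
  by (auto simp: interior_injective_linear_image linear_conv_bounded_linear
      intro!: compact_continuous_image linear_continuous_on convex_linear_image)

text \<open>Because \<open>T y \<bullet> u = y \<bullet> adjoint T u\<close>, both sides state the
  same supporting inequality up to a positive factor.\<close>

lemma outer_unit_normal_linear_image:
  assumes "norm u = 1"
  shows "outer_unit_normal (T ` K) (T x) u \<longleftrightarrow>
         outer_unit_normal K x (adjoint T u /\<^sub>R norm (adjoint T u))"
proof -
  have "adjoint T u \<noteq> 0" by (rule adjoint_T_nonzero[OF assms])
  then show ?thesis using assms bij_is_inj[OF bijT]
    by (auto simp: outer_unit_normal_def frontier_linear_image adjoint_works[OF linT] inj_image_mem_iff)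
qed

section \<open>Gauss map, curvature and support function of the image of one body\<close>

context
  fixes K :: "(real^'n) set"
  assumes K: "convex_body K" and C2: "C2_plus K"
begin

text \<open>On unit vectors the normalized maps \<open>adjoint T\<close> and
  \<open>adjoint (inv T)\<close> are inverse to each other, so
  \<open>outer_unit_normal_linear_image\<close> can be solved for \<open>u\<close>.\<close>

lemma gauss_map_linear_image:
  assumes x: "x \<in> frontier K"
  shows "gauss_map (T ` K) (T x) =
     adjoint (inv T) (gauss_map K x) /\<^sub>R norm (adjoint (inv T) (gauss_map K x))"
proof -
  let ?S = "adjoint (inv T)" and ?\<nu> = "gauss_map K x"
  have lS: "linear ?S" by (rule adjoint_linear[OF linear_inv_T])
  have iff: "outer_unit_normal K x v \<longleftrightarrow> v = ?\<nu>" for v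
    using outer_unit_normal_iff_gauss_map[OF K _ x] C2 by (simp add: C2_plus_def)
  then have \<nu>: "norm ?\<nu> = 1" by (auto simp: outer_unit_normal_def)
  have S0: "?S ?\<nu> \<noteq> 0"
    using adjoint_adjoint_inv[of ?\<nu>] \<nu> linear_0[OF adjoint_linear[OF linT]] by auto
  have eq: "outer_unit_normal (T ` K) (T x) u \<longleftrightarrow> u = ?S ?\<nu> /\<^sub>R norm (?S ?\<nu>)" for u
  proof (cases "norm u = 1")
    case True
    have L0: "adjoint T u \<noteq> 0" by (rule adjoint_T_nonzero[OF True])
    have "adjoint T u /\<^sub>R norm (adjoint T u) = ?\<nu> \<longleftrightarrow> u = ?S ?\<nu> /\<^sub>R norm (?S ?\<nu>)"
    proof
      assume *: "adjoint T u /\<^sub>R norm (adjoint T u) = ?\<nu>"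
      have "?S ?\<nu> = u /\<^sub>R norm (adjoint T u)"
        unfolding *[symmetric] using lS by (simp add: linear_scale adjoint_inv_adjoint)
      then show "u = ?S ?\<nu> /\<^sub>R norm (?S ?\<nu>)" using L0 True by simp
    next
      assume *: "u = ?S ?\<nu> /\<^sub>R norm (?S ?\<nu>)"
      have "adjoint T u = ?\<nu> /\<^sub>R norm (?S ?\<nu>)"
        unfolding * using adjoint_linear[OF linT] by (simp add: linear_scale adjoint_adjoint_inv)
      then show "adjoint T u /\<^sub>R norm (adjoint T u) = ?\<nu>" using S0 \<nu> by simp
    qed
    then show ?thesis by (simp add: outer_unit_normal_linear_image[OF True] iff)
  next
    case False
    then show ?thesis using S0 by (auto simp: outer_unit_normal_def)
  qed
  show ?thesis unfolding gauss_map_def[of "T ` K"] eq by simp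
qed

text \<open>The new Gauss map is \<open>inv T\<close>, then the old Gauss map, then
  \<open>adjoint (inv T)\<close>, then normalization. The chain rule gives its derivative
  \<open>D0\<close>, and \<open>det_normal_extension_transform\<close> compares the
  determinants.\<close>

lemma gauss_curvature_linear_image:
  assumes x: "x \<in> frontier K"
  shows "gauss_curvature (T ` K) (T x) * norm (adjoint (inv T) (gauss_map K x)) ^ (CARD('n) + 1)
           * (det (matrix T))\<^sup>2 = gauss_curvature K x"
proof -
  let ?S = "adjoint (inv T)" and ?\<nu> = "gauss_map K x"
  have lS: "linear ?S" by (rule adjoint_linear[OF linear_inv_T])
  define n where "n = ?S ?\<nu> /\<^sub>R norm (?S ?\<nu>)"
  have C2': "C2_hypersurface (frontier K)" using C2 by (simp add: C2_plus_def)
  have \<nu>: "norm ?\<nu> = 1"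
    using outer_unit_normal_iff_gauss_map[OF K C2' x, of ?\<nu>] by (simp add: outer_unit_normal_def)
  have S0: "?S ?\<nu> \<noteq> 0"
    using adjoint_adjoint_inv[of ?\<nu>] \<nu> linear_0[OF adjoint_linear[OF linT]] by auto
  let ?D = "frechet_derivative (gauss_map K) (at x within frontier K)"
  let ?D' = "frechet_derivative (gauss_map (T ` K)) (at (T x) within T ` frontier K)"
  define D0 where "D0 = (\<lambda>w. (?S (?D (inv T w)) - (?S (?D (inv T w)) \<bullet> n) *\<^sub>R n) /\<^sub>R norm (?S ?\<nu>))"
  have D: "(gauss_map K has_derivative ?D) (at x within frontier K)"
    by (rule gauss_map_has_derivative[OF K C2 x])
  have img: "inv T ` T ` frontier K = frontier K" by (simp add: image_image inv_T_T)
  have dT': "(inv T has_derivative inv T) (at (T x) within T ` frontier K)"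
    using linear_inv_T by (simp add: linear_imp_has_derivative)
  have "((\<lambda>y. gauss_map K (inv T y)) has_derivative (\<lambda>w. ?D (inv T w))) (at (T x) within T ` frontier K)"
    using diff_chain_within[OF dT', of "gauss_map K" ?D] D unfolding img by (simp add: o_def inv_T_T)
  then have 1: "((\<lambda>y. ?S (gauss_map K (inv T y))) has_derivative (\<lambda>w. ?S (?D (inv T w))))
      (at (T x) within T ` frontier K)"
    by (rule bounded_linear.has_derivative[OF lS[unfolded linear_conv_bounded_linear]])
  have 2: "((\<lambda>y. y /\<^sub>R norm y) has_derivative (\<lambda>w. (w - (w \<bullet> n) *\<^sub>R n) /\<^sub>R norm (?S ?\<nu>)))
      (at (?S (gauss_map K (inv T (T x)))) within (\<lambda>y. ?S (gauss_map K (inv T y))) ` T ` frontier K)"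
    using has_derivative_normalize[OF S0] by (simp only: n_def inv_T_T)
  have comp: "((\<lambda>y. ?S (gauss_map K (inv T y)) /\<^sub>R norm (?S (gauss_map K (inv T y))))
      has_derivative D0) (at (T x) within T ` frontier K)"
    using diff_chain_within[OF 1 2] by (simp only: o_def D0_def)
  have D0: "(gauss_map (T ` K) has_derivative D0) (at (T x) within T ` frontier K)"
  proof (rule has_derivative_transform[OF _ _ comp])
    show "gauss_map (T ` K) y = ?S (gauss_map K (inv T y)) /\<^sub>R norm (?S (gauss_map K (inv T y)))"
      if "y \<in> T ` frontier K" for y
      using that gauss_map_linear_image[of "inv T y"] by (auto simp: inv_T_T)
  qed (use x in blast)
  then have "gauss_map (T ` K) differentiable (at (T x) within T ` frontier K)"
    by (rule differentiableI)
  then have D': "(gauss_map (T ` K) has_derivative ?D') (at (T x) within T ` frontier K)"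
    by (simp only: frechet_derivative_works)
  \<comment> \<open>\<open>frechet_derivative\<close> chooses some derivative within the
    hypersurface. It is forced to agree with \<open>D0\<close> on tangent vectors, and the curvature
    applies it to no others.\<close>
  have D'w: "?D' w = D0 w" if "w \<bullet> n = 0" for w
  proof (rule has_derivative_unique_tangent[OF D' D0])
    have "w \<bullet> ?S ?\<nu> = 0" using that S0 by (simp add: n_def)
    then have "inv T w \<bullet> ?\<nu> = 0"
      using adjoint_inv_T[of ?\<nu> "inv T w"] by (simp add: T_inv_T inner_commute)
    then have "tangent_vector (frontier K) x (inv T w)"
      by (rule tangent_vector_frontier[OF K C2' x])
    from tangent_vector_linear_image[OF linT this]
    show "tangent_vector (T ` frontier K) (T x) w" by (simp add: T_inv_T)
  qed
  have "det (matrix (\<lambda>v. ?D' (v - (v \<bullet> n) *\<^sub>R n) + (v \<bullet> n) *\<^sub>R n)) * norm (?S ?\<nu>) ^ (CARD('n) + 1)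
      * (det (matrix T))\<^sup>2 = det (matrix (\<lambda>v. ?D (v - (v \<bullet> ?\<nu>) *\<^sub>R ?\<nu>) + (v \<bullet> ?\<nu>) *\<^sub>R ?\<nu>))"
    by (rule det_normal_extension_transform[OF linT linear_inv_T lS has_derivative_linear[OF D]
          has_derivative_linear[OF D'] inv_T_T T_inv_T adjoint_inv_T \<nu> n_def])
      (simp add: D'w D0_def)
  moreover have "gauss_map (T ` K) (T x) = n" by (simp add: gauss_map_linear_image x n_def)
  ultimately show ?thesis by (simp add: gauss_curvature_def frontier_linear_image Let_def)
qed

text \<open>Everything is read off at the point \<open>x\<close> of \<open>K\<close> with normal
  \<open>v\<close>, since \<open>T x\<close> then has normal \<open>u\<close>. The curvature formula
  applies with \<open>norm (adjoint (inv T) v) = 1 / norm (adjoint T u)\<close>.\<close>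

lemma
  assumes u: "norm u = 1"
  shows support_function_linear_image: "support_function (T ` K) u =
      norm (adjoint T u) * support_function K (adjoint T u /\<^sub>R norm (adjoint T u))"
    and curvature_function_linear_image: "curvature_function (T ` K) u =
      (det (matrix T))\<^sup>2 / norm (adjoint T u) ^ (CARD('n) + 1)
        * curvature_function K (adjoint T u /\<^sub>R norm (adjoint T u))"
proof -
  let ?S = "adjoint (inv T)"
  define v where "v = adjoint T u /\<^sub>R norm (adjoint T u)"
  have L0: "adjoint T u \<noteq> 0" by (rule adjoint_T_nonzero[OF u])
  have v: "norm v = 1" using L0 by (simp add: v_def)
  obtain x where x: "outer_unit_normal K x v" using outer_unit_normal_point_exists[OF K v] by blast
  have xf: "x \<in> frontier K" using x by (simp add: outer_unit_normal_def)
  have Tx: "outer_unit_normal (T ` K) (T x) u"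
    using outer_unit_normal_linear_image[OF u] x by (simp add: v_def)
  have "support_function (T ` K) u = T x \<bullet> u"
    by (rule support_function_eq[OF convex_body_linear_image[OF K] Tx])
  also have "\<dots> = norm (adjoint T u) * (x \<bullet> v)" using L0 by (simp add: v_def adjoint_works[OF linT])
  also have "x \<bullet> v = support_function K v" by (rule support_function_eq[OF K x, symmetric])
  finally show "support_function (T ` K) u =
      norm (adjoint T u) * support_function K (adjoint T u /\<^sub>R norm (adjoint T u))"
    by (simp add: v_def)
  \<comment> \<open>Uniqueness of the point with normal \<open>u\<close> is pulled back along
    \<open>T\<close> to uniqueness in \<open>K\<close>.\<close>
  have "(THE y. outer_unit_normal (T ` K) y u) = T x"
  proof (rule the_equality, rule Tx)
    fix y assume y: "outer_unit_normal (T ` K) y u"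
    then obtain x' where x': "y = T x'" by (metis T_inv_T)
    have "outer_unit_normal K x' v"
      using outer_unit_normal_linear_image[OF u] y by (simp add: x' v_def)
    then show "y = T x" using outer_unit_normal_point_unique[OF K C2 _ x] x' by blast
  qed
  then have f': "curvature_function (T ` K) u = 1 / gauss_curvature (T ` K) (T x)"
    by (simp add: curvature_function_def)
  have f: "curvature_function K v = 1 / gauss_curvature K x"
    by (rule curvature_function_eq[OF K C2 x])
  have "v = gauss_map K x"
    using outer_unit_normal_iff_gauss_map[OF K _ xf] C2 x by (simp add: C2_plus_def)
  moreover have "?S v = u /\<^sub>R norm (adjoint T u)"
    using adjoint_linear[OF linear_inv_T] by (simp add: v_def linear_scale adjoint_inv_adjoint)
  ultimately have "norm (?S (gauss_map K x)) = 1 / norm (adjoint T u)"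
    using u by (simp add: divide_inverse)
  with gauss_curvature_linear_image[OF xf]
  have g: "gauss_curvature (T ` K) (T x) * (1 / norm (adjoint T u)) ^ (CARD('n) + 1)
      * (det (matrix T))\<^sup>2 = gauss_curvature K x"
    by simp
  \<comment> \<open>This includes \<open>c = 0\<close>, where both sides are 0 because
    \<open>1 / 0 = 0\<close>.\<close>
  have algebra: "1 / c = d / l ^ m * (1 / (c * (1 / l) ^ m * d))"
    if "d \<noteq> 0" "l \<noteq> 0" for c d l :: real and m
    using that by (simp add: power_one_over)
  \<comment> \<open>A vanishing determinant would, by \<open>g\<close>, make the curvature of
    \<open>K\<close> at \<open>x\<close> zero.\<close>
  have "det (matrix T) \<noteq> 0" using g C2 xf by (auto simp: C2_plus_def)
  then have "1 / gauss_curvature (T ` K) (T x) =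
      (det (matrix T))\<^sup>2 / norm (adjoint T u) ^ (CARD('n) + 1) * (1 / gauss_curvature K x)"
    unfolding g[symmetric] by (intro algebra) (use L0 in auto)
  then show "curvature_function (T ` K) u =
      (det (matrix T))\<^sup>2 / norm (adjoint T u) ^ (CARD('n) + 1)
        * curvature_function K (adjoint T u /\<^sub>R norm (adjoint T u))"
    by (simp only: f f' v_def[symmetric])
qed

end

end

section \<open>Linear change of variables on the sphere\<close>

text \<open>The library proves this only for index types of class \<open>wellorder\<close>.\<close>

lemma lmeasure_linear_image:
  fixes f :: "real^'n \<Rightarrow> real^'n"
  assumes "linear f" "S \<in> lmeasurable"
  shows "f ` S \<in> lmeasurable \<and> measure lebesgue (f ` S) = \<bar>det (matrix f)\<bar> * measure lebesgue S"
proof -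
  let ?P = "\<lambda>f :: real^'n \<Rightarrow> real^'n. \<forall>S\<in>lmeasurable. f ` S \<in> lmeasurable \<and>
    measure lebesgue (f ` S) = \<bar>det (matrix f)\<bar> * measure lebesgue S"
  \<comment> \<open>This serves the swaps and shears, whose determinants have absolute value 1:
    preserving the volume of boxes is enough.\<close>
  have unimodular: "?P f" if "linear f" "\<bar>det (matrix f)\<bar> = 1"
    "\<And>a b. cbox a b \<noteq> {} \<Longrightarrow> measure lebesgue (f ` cbox a b) = measure lebesgue (cbox a b)"
    for f :: "real^'n \<Rightarrow> real^'n"
  proof
    fix S :: "(real^'n) set" assume S: "S \<in> lmeasurable"
    have "measure lebesgue (f ` cbox a b) = 1 * measure lebesgue (cbox a b)" for a b
      using that(3)[of a b] by (cases "cbox a b = {}") auto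
    from measure_linear_sufficient[OF that(1) S this]
    show "f ` S \<in> lmeasurable \<and> measure lebesgue (f ` S) = \<bar>det (matrix f)\<bar> * measure lebesgue S"
      using that(2) by simp
  qed
  have "?P f"
  proof (rule induct_linear_elementary[OF assms(1)])
    fix f g :: "real^'n \<Rightarrow> real^'n"
    assume "linear f" "linear g" "?P f" "?P g"
    moreover have "det (matrix (f \<circ> g)) = det (matrix f) * det (matrix g)"
      unfolding o_def by (rule det_matrix_compose) fact+
    ultimately show "?P (f \<circ> g)"
      unfolding image_comp[symmetric] by (simp add: abs_mult del: image_image)
  next
    fix f :: "real^'n \<Rightarrow> real^'n" and i
    assume lf: "linear f" and 0: "\<And>x. f x $ i = 0"
    \<comment> \<open>The image lies in a coordinate hyperplane, so both sides of the volume formula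
      are 0.\<close>
    have "\<not> surj f" using 0 by (metis one_neq_zero surjE vec_component)
    then have ninj: "\<not> inj f" using lf linear_injective_imp_surjective by blast
    then have "det (matrix f) = 0" using det_nz_iff_inj[OF lf] by blast
    moreover have "negligible (f ` S)" for S
      by (rule negligible_linear_singular_image[OF lf ninj])
    ultimately show "?P f"
      by (simp add: negligible_iff_measure)
  next
    fix c :: "'n \<Rightarrow> real"
    have "det (matrix (\<lambda>x. \<chi> i. c i * x $ i)) = prod c UNIV"
      by (subst det_diagonal) (auto simp: matrix_def axis_def)
    then show "?P (\<lambda>x. \<chi> i. c i * x $ i)"
      by (simp add: measurable_stretch measure_stretch)
  next
    fix m n :: 'n assume "m \<noteq> n"
    let ?h = "\<lambda>x::real^'n. \<chi> i. x $ Transposition.transpose m n i"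
    show "?P ?h"
    proof (rule unimodular)
      show lin: "linear ?h" by (rule linearI) (simp_all add: vec_eq_iff)
      have "norm (?h x) = norm x" for x
        unfolding norm_vec_def L2_set_def
        using sum.permute[OF permutes_swap_id[of m UNIV n], of "\<lambda>i. (norm (x $ i))\<^sup>2"] by (simp add: o_def)
      then have "orthogonal_transformation ?h" using lin by (simp add: orthogonal_transformation)
      then show "\<bar>det (matrix ?h)\<bar> = 1" by (rule orthogonal_transformation_det)
      fix a b :: "real^'n" assume ne: "cbox a b \<noteq> {}"
      have eq: "?h ` cbox a b = cbox (?h a) (?h b)"
      proof (intro equalityI subsetI)
        fix y assume y: "y \<in> cbox (?h a) (?h b)"
        have "?h y \<in> cbox a b"
          using y by (simp add: mem_box_cart) (metis transpose_involutory)
        moreover have "y = ?h (?h y)" by (simp add: vec_eq_iff)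
        ultimately show "y \<in> ?h ` cbox a b" by blast
      qed (auto simp: mem_box_cart)
      then have "cbox (?h a) (?h b) \<noteq> {}" using ne by auto
      then show "measure lebesgue (?h ` cbox a b) = measure lebesgue (cbox a b)"
        using prod.permute[OF permutes_swap_id[of m UNIV n], of "\<lambda>i. b $ i - a $ i"] ne
        by (simp add: eq content_cbox_cart o_def)
    qed
  next
    fix m n :: 'n assume mn: "m \<noteq> n"
    let ?h = "\<lambda>x::real^'n. \<chi> i. if i = m then x $ m + x $ n else x $ i"
    have h: "?h = (\<lambda>v. v + (v \<bullet> axis n 1) *\<^sub>R axis m 1)"
      by (simp add: fun_eq_iff vec_eq_iff inner_axis) (auto simp: axis_def)
    show "?P ?h"
    proof (rule unimodular)
      show lin: "linear ?h" unfolding h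
        by (intro linearI) (auto simp: algebra_simps inner_add_left)
      show "\<bar>det (matrix ?h)\<bar> = 1"
        unfolding h det_rank_one_update using mn by (simp add: inner_axis_axis)
      fix a b :: "real^'n" assume ne: "cbox a b \<noteq> {}"
      \<comment> \<open>\<open>measure_shear_interval\<close> asks for a box whose lower corner has
        a nonnegative coordinate \<open>n\<close>. Translating by \<open>t\<close> moves that
        coordinate to 0.\<close>
      define t where "t = axis n (- (a $ n))"
      have box: "cbox (t + a) (t + b) = (+) t ` cbox a b" by (simp add: cbox_translation)
      have him: "?h ` (+) t ` cbox a b = (+) (?h t) ` ?h ` cbox a b"
        unfolding image_image by (intro image_cong refl linear_add[OF lin])
      have "measure lebesgue (?h ` cbox a b) = measure lebesgue (?h ` cbox (t + a) (t + b))"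
        unfolding box him by (rule measure_translation[symmetric])
      also have "\<dots> = measure lebesgue (cbox (t + a) (t + b))"
      proof (rule measure_shear_interval[OF mn])
        show "cbox (t + a) (t + b) \<noteq> {}" using ne unfolding box by simp
        show "0 \<le> (t + a) $ n" by (simp add: t_def)
      qed
      also have "\<dots> = measure lebesgue (cbox a b)" unfolding box by (rule measure_translation)
      finally show "measure lebesgue (?h ` cbox a b) = measure lebesgue (cbox a b)" .
    qed
  qed
  then show ?thesis using assms(2) by blast
qed

section \<open>Spherical integrals as volumes of radial sets\<close>

abbreviation sphere_borel :: "(real^'n) measure" where
  "sphere_borel \<equiv> restrict_space borel (sphere 0 1)"

lemma sets_sphere_measure [measurable_cong]: "sets sphere_measure = sets sphere_borel"
  by (simp add: sphere_measure_def)

lemma space_sphere_measure: "space sphere_measure = sphere 0 1"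
  using sets_eq_imp_space_eq[OF sets_sphere_measure] by (simp add: space_restrict_space)

lemma normalize_measurable: "(\<lambda>x. x /\<^sub>R norm x) \<in> restrict_space borel (- {0}) \<rightarrow>\<^sub>M (sphere_borel :: (real^'n) measure)"
  by (intro measurable_restrict_space3) auto

text \<open>In direction \<open>v\<close> the set reaches up to the radius whose \<open>n\<close>-th
  power is \<open>h v\<close>, where \<open>n = CARD('n)\<close>. This power makes the volume linear
  in \<open>h\<close>, namely the spherical integral divided by \<open>n\<close>.\<close>

definition radial_set :: "(real^'n \<Rightarrow> ennreal) \<Rightarrow> (real^'n) set" where
  "radial_set h = {x. x \<noteq> 0 \<and> ennreal (norm x ^ CARD('n)) < h (x /\<^sub>R norm x)}"

lemma radial_set_borel:
  fixes h :: "real^'n \<Rightarrow> ennreal"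
  assumes h: "h \<in> borel_measurable sphere_borel"
  shows "radial_set h \<in> sets borel"
proof -
  have [measurable]: "(\<lambda>x. h (x /\<^sub>R norm x)) \<in> borel_measurable (restrict_space borel (- {0}))"
    by (rule measurable_compose[OF normalize_measurable h])
  have [measurable]: "(\<lambda>x::real^'n. ennreal (norm x ^ CARD('n))) \<in> borel_measurable (restrict_space borel (- {0}))"
    by (rule measurable_restrict_space1) measurable
  have "{x \<in> space (restrict_space borel (- {0})). ennreal (norm x ^ CARD('n)) < h (x /\<^sub>R norm x)}
     \<in> sets (restrict_space borel (- {0}))"
    by measurable
  moreover have "radial_set h = {x \<in> space (restrict_space borel (- {0})). ennreal (norm x ^ CARD('n)) < h (x /\<^sub>R norm x)}"
    by (auto simp: radial_set_def space_restrict_space)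
  ultimately show ?thesis by (simp add: sets_restrict_space_iff)
qed

lemma emeasure_lborel_scale:
  fixes S :: "'a::euclidean_space set"
  assumes "r \<noteq> 0" "S \<in> sets borel"
  shows "emeasure lborel S = ennreal (\<bar>r\<bar> ^ DIM('a)) * emeasure lborel {x. r *\<^sub>R x \<in> S}"
proof -
  have [measurable]: "(\<lambda>x::'a. r *\<^sub>R x) \<in> borel_measurable borel" by measurable
  have "emeasure lborel S = emeasure (density (distr lborel borel (\<lambda>x. 0 + r *\<^sub>R x)) (\<lambda>_. \<bar>r\<bar> ^ DIM('a))) S"
    by (subst lborel_affine[OF assms(1), of 0]) simp
  also have "\<dots> = ennreal (\<bar>r\<bar> ^ DIM('a)) * emeasure (distr lborel borel (\<lambda>x. r *\<^sub>R x)) S"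
    using assms(2) by (subst emeasure_density_const) auto
  also have "emeasure (distr lborel borel (\<lambda>x. r *\<^sub>R x)) S = emeasure lborel {x. r *\<^sub>R x \<in> S}"
    using assms(2) by (subst emeasure_distr) (auto simp: vimage_def)
  finally show ?thesis .
qed

text \<open>The radial set of an indicator is the cone over \<open>A\<close> without its points of
  norm 1. The cone in \<open>sphere_measure\<close> contains them, but they form a null set.\<close>

lemma emeasure_sphere_measure:
  fixes A :: "(real^'n) set"
  assumes A: "A \<in> sets sphere_borel"
  shows "emeasure sphere_measure A = of_nat CARD('n) * emeasure lborel (radial_set (indicator A))"
proof -
  let ?C = "{x. x \<noteq> 0 \<and> norm x \<le> 1 \<and> x /\<^sub>R norm x \<in> A}"
  have "radial_set (indicator A) = {x. x \<noteq> 0 \<and> norm x < 1 \<and> x /\<^sub>R norm x \<in> A}" (is "_ = ?C'")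
    by (auto simp: radial_set_def indicator_def power_less_one_iff ennreal_less_one_iff)
  then have C': "?C' \<in> sets borel" using radial_set_borel[of "indicator A"] A by simp
  have N: "(\<lambda>x. x /\<^sub>R norm x) \<in> restrict_space lborel (cball 0 1 - {0}) \<rightarrow>\<^sub>M (sphere_borel :: (real^'n) measure)"
    by (intro measurable_restrict_space3) auto
  have C: "(\<lambda>x. x /\<^sub>R norm x) -` A \<inter> space (restrict_space lborel (cball 0 1 - {0})) = ?C"
    by (auto simp: space_restrict_space)
  have "?C \<in> sets (restrict_space lborel (cball 0 1 - {0}))"
    using measurable_sets[OF N A] unfolding C .
  then have Cb: "?C \<in> sets lborel" by (subst (asm) sets_restrict_space_iff) auto
  have "emeasure sphere_measure A = of_nat CARD('n) * emeasure (restrict_space lborel (cball 0 1 - {0})) ?C"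
    unfolding sphere_measure_def using A C by (simp add: emeasure_distr[OF N])
  also have "emeasure (restrict_space lborel (cball 0 1 - {0})) ?C = emeasure lborel ?C"
    by (rule emeasure_restrict_space) auto
  also have "\<dots> = emeasure lborel ?C'"
  proof (rule emeasure_eq_AE)
    have "sphere (0::real^'n) 1 \<in> null_sets lborel"
      using negligible_sphere[of "0::real^'n" 1] by (simp add: negligible_iff_null_sets null_sets_completion_iff)
    from AE_not_in[OF this] show "AE x in lborel. x \<in> ?C \<longleftrightarrow> x \<in> ?C'" by eventually_elim auto
  qed (use Cb C' in auto)
  finally show ?thesis using \<open>radial_set _ = ?C'\<close> by simp
qed

text \<open>Each step of the induction on \<open>h\<close> has a geometric counterpart:
  multiplication by a constant dilates the radial set, adding functions with disjoint supports gives
  a disjoint union, and an increasing supremum gives an increasing union.\<close>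

lemma nn_integral_sphere_measure:
  fixes h :: "real^'n \<Rightarrow> ennreal"
  assumes "h \<in> borel_measurable sphere_borel"
  shows "(\<integral>\<^sup>+u. h u \<partial>sphere_measure) = of_nat CARD('n) * emeasure lborel (radial_set h)"
  using assms
proof (induction rule: borel_measurable_induct)
  case (cong f g)
  have "(\<integral>\<^sup>+u. f u \<partial>sphere_measure) = (\<integral>\<^sup>+u. g u \<partial>sphere_measure)"
    using cong by (intro nn_integral_cong) (simp add: space_sphere_measure space_restrict_space)
  moreover have "radial_set f = radial_set g"
    using cong by (auto simp: radial_set_def space_restrict_space)
  ultimately show ?case using cong by simp
next
  case (set A)
  then show ?case by (simp add: emeasure_sphere_measure sets_sphere_measure)
next
  case (mult u c)
  note [measurable] = mult(2)
  show ?case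
  proof (cases "c = 0")
    case True
    then show ?thesis by (simp add: radial_set_def)
  next
    case False
    obtain r0 where r0: "c = ennreal r0" "r0 > 0"
      using mult(1) False by (cases c) (auto simp: top_unique less_le)
    \<comment> \<open>Dilation by \<open>r\<close> multiplies volumes by
      \<open>r ^ CARD('n)\<close>, which has to equal \<open>c\<close>.\<close>
    define r where "r = root CARD('n) r0"
    have r: "r > 0" "r ^ CARD('n) = r0" using r0 by (simp_all add: r_def)
    have iff: "ennreal ((r * norm x) ^ CARD('n)) < c * u v \<longleftrightarrow> ennreal (norm x ^ CARD('n)) < u v" for x v :: "real^'n"
    proof -
      have "ennreal ((r * norm x) ^ CARD('n)) = c * ennreal (norm x ^ CARD('n))"
        using r r0 by (simp add: power_mult_distrib ennreal_mult)
      moreover have "c * a < c * b \<longleftrightarrow> a < b" for a b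
        using ennreal_mult_strict_left_mono[of a b c] mult_left_mono[of b a c] mult(1) False
        by (auto simp: not_le[symmetric] zero_less_iff_neq_zero)
      ultimately show ?thesis by simp
    qed
    have "{x. r *\<^sub>R x \<in> radial_set (\<lambda>x. c * u x)} = radial_set u"
    proof -
      have "(r *\<^sub>R x) /\<^sub>R norm (r *\<^sub>R x) = x /\<^sub>R norm x" for x :: "real^'n" using r(1) by simp
      moreover have "norm (r *\<^sub>R x) = r * norm x" for x :: "real^'n" using r(1) by simp
      ultimately show ?thesis
        unfolding radial_set_def mem_Collect_eq using r(1) iff by (simp del: scaleR_scaleR norm_scaleR)
    qed
    moreover have "radial_set (\<lambda>x. c * u x) \<in> sets borel" by (rule radial_set_borel) measurable
    ultimately have "emeasure lborel (radial_set (\<lambda>x. c * u x)) = c * emeasure lborel (radial_set u)"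
      using emeasure_lborel_scale[of r "radial_set (\<lambda>x. c * u x)"] r r0 by simp
    moreover have "u \<in> borel_measurable sphere_measure" by measurable
    ultimately show ?thesis using mult by (simp add: nn_integral_cmult mult.left_commute)
  qed
next
  case (add u v)
  note [measurable] = add(1,3)
  \<comment> \<open>The induction rule supplies summands with disjoint supports, so in each
    direction the sum is just one of them.\<close>
  have dis: "u x = 0 \<or> v x = 0" if "norm x = 1" for x
    using add that by (auto simp: space_restrict_space)
  have "radial_set (\<lambda>x. v x + u x) = radial_set v \<union> radial_set u"
  proof -
    have "ennreal (norm x ^ CARD('n)) < v y + u y \<longleftrightarrow> ennreal (norm x ^ CARD('n)) < v y \<or> ennreal (norm x ^ CARD('n)) < u y"
      if "norm y = 1" for x y :: "real^'n"
      using dis[OF that] by auto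
    then show ?thesis by (auto simp: radial_set_def)
  qed
  moreover have "radial_set v \<inter> radial_set u = {}"
  proof -
    have "\<not> (ennreal a < v y \<and> ennreal a < u y)" if "norm y = 1" for a and y :: "real^'n"
      using dis[OF that] by auto
    then show ?thesis by (auto simp: radial_set_def)
  qed
  ultimately have "emeasure lborel (radial_set (\<lambda>x. v x + u x)) = emeasure lborel (radial_set v) + emeasure lborel (radial_set u)"
    using radial_set_borel[OF add(1)] radial_set_borel[OF add(3)] by (simp add: plus_emeasure)
  moreover have "u \<in> borel_measurable sphere_measure" "v \<in> borel_measurable sphere_measure" by measurable
  ultimately show ?case using add by (simp add: nn_integral_add distrib_left)
next
  case (seq U)
  note [measurable] = seq(1)
  \<comment> \<open>The strict inequality in \<open>radial_set\<close> matters here: a number lies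
    below a supremum iff it lies below some member.\<close>
  have "radial_set (SUP i. U i) = (\<Union>i. radial_set (U i))"
    by (auto simp: radial_set_def less_SUP_iff)
  moreover have "incseq (\<lambda>i. radial_set (U i))"
    using seq(3) by (fastforce simp: incseq_def radial_set_def le_fun_def intro: less_le_trans)
  ultimately have "emeasure lborel (radial_set (SUP i. U i)) = (SUP i. emeasure lborel (radial_set (U i)))"
    using radial_set_borel[OF seq(1)] by (subst SUP_emeasure_incseq) auto
  moreover have "(\<integral>\<^sup>+u. Sup (range U) u \<partial>sphere_measure) = (SUP i. integral\<^sup>N sphere_measure (U i))"
    using nn_integral_monotone_convergence_SUP[OF seq(3), of sphere_measure] by (simp add: image_comp)
  ultimately show ?case
    by (simp only: seq.IH SUP_mult_left_ennreal)
qed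

text \<open>A linear bijection \<open>L\<close> maps the radial set of \<open>A \<circ> \<phi> / |L|\<^sup>n\<close> onto the one of \<open>A\<close>.\<close>

lemma
  fixes L :: "real^'n \<Rightarrow> real^'n"
  assumes L: "linear L" "bij L"
  defines "\<phi> \<equiv> \<lambda>u. L u /\<^sub>R norm (L u)"
    and "w \<equiv> \<lambda>u. \<bar>det (matrix L)\<bar> / norm (L u) ^ CARD('n)"
  shows sphere_projective_measurable: "\<phi> \<in> sphere_borel \<rightarrow>\<^sub>M sphere_borel"
    and distr_density_sphere_measure:
      "distr (density sphere_measure (\<lambda>u. ennreal (w u))) sphere_borel \<phi> = sphere_measure"
proof -
  have [measurable]: "L \<in> borel_measurable borel"
    using L(1) by (intro borel_measurable_continuous_onI linear_continuous_on) (simp add: linear_conv_bounded_linear)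
  have L0: "L x = 0 \<longleftrightarrow> x = 0" for x
    using L by (metis bij_is_inj linear_injective_0 linear_0)
  show \<phi>: "\<phi> \<in> sphere_borel \<rightarrow>\<^sub>M sphere_borel"
  proof -
    have "L x \<noteq> 0" if "norm x = 1" for x using that by (auto simp: L0)
    then show ?thesis unfolding \<phi>_def by (intro measurable_restrict_space3) auto
  qed
  have w[measurable]: "w \<in> borel_measurable sphere_borel"
    unfolding w_def by (intro measurable_restrict_space1) measurable
  note [measurable] = \<phi>
  show "distr (density sphere_measure (\<lambda>u. ennreal (w u))) sphere_borel \<phi> = sphere_measure"
  proof (rule measure_eqI)
    fix A assume "A \<in> sets (distr (density sphere_measure (\<lambda>u. ennreal (w u))) sphere_borel \<phi>)"
    then have A[measurable]: "A \<in> sets sphere_borel" by simp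
    \<comment> \<open>Up to the constant \<open>\<bar>det (matrix L)\<bar>\<close>, this is the
      density \<open>w\<close> restricted to the preimage of \<open>A\<close>.\<close>
    define h where "h = (\<lambda>u. ennreal (1 / norm (L u) ^ CARD('n)) * indicator A (\<phi> u))"
    have [measurable]: "(\<lambda>u. ennreal (1 / norm (L u) ^ CARD('n))) \<in> borel_measurable sphere_borel"
      by (intro measurable_restrict_space1) measurable
    have h[measurable]: "h \<in> borel_measurable sphere_borel" unfolding h_def by measurable
    have hs: "h \<in> borel_measurable sphere_measure" by measurable
    have iff: "x \<in> radial_set h \<longleftrightarrow> L x \<in> radial_set (indicator A)" for x
    proof (cases "x = 0")
      case False
      have \<phi>x: "\<phi> (x /\<^sub>R norm x) = L x /\<^sub>R norm (L x)"
        using L(1) False by (simp add: \<phi>_def linear_scale)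
      have c: "1 / norm (L (x /\<^sub>R norm x)) ^ CARD('n) = norm x ^ CARD('n) / norm (L x) ^ CARD('n)"
        using L(1) False by (simp add: linear_scale power_mult_distrib field_simps)
      \<comment> \<open>The powers of \<open>norm x\<close> cancel, which turns the condition on
        \<open>x\<close> into membership of \<open>L x\<close> in the unit ball.\<close>
      have "norm x ^ CARD('n) < norm x ^ CARD('n) / norm (L x) ^ CARD('n) \<longleftrightarrow> norm (L x) ^ CARD('n) < 1"
        using False L0 by (simp add: field_simps)
      then have "ennreal (norm x ^ CARD('n)) < ennreal (1 / norm (L (x /\<^sub>R norm x)) ^ CARD('n))
          \<longleftrightarrow> ennreal (norm (L x) ^ CARD('n)) < 1"
        unfolding c ennreal_less_one_iff by (subst ennreal_less_iff) auto
      moreover have "L x \<noteq> 0" using False L0 by simp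
      ultimately show ?thesis
        using False unfolding radial_set_def mem_Collect_eq h_def \<phi>x
        by (cases "L x /\<^sub>R norm (L x) \<in> A") (simp_all only: indicator_simps mult_1_right mult_zero_right not_less_zero simp_thms)
    qed (simp add: radial_set_def L0)
    \<comment> \<open>Finite volume permits passing between \<open>emeasure\<close> and the
      real-valued \<open>measure\<close> of the linear rule.\<close>
    have "bounded (radial_set (indicator A :: real^'n \<Rightarrow> ennreal))"
      by (rule bounded_subset[OF bounded_ball[of 0 1]])
        (auto simp: radial_set_def indicator_def power_less_one_iff ennreal_less_one_iff split: if_splits)
    moreover have "radial_set (indicator A :: real^'n \<Rightarrow> ennreal) \<in> sets borel"
      by (rule radial_set_borel) measurable
    ultimately have RA: "radial_set (indicator A :: real^'n \<Rightarrow> ennreal) \<in> lmeasurable"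
      by (intro bounded_set_imp_lmeasurable) auto
    have lL': "linear (inv L)" using L by (metis bij_is_inj inj_linear_imp_inv_linear)
    have Rh: "radial_set h = inv L ` radial_set (indicator A)"
      using iff L(2) by (force simp: bij_is_inj bij_is_surj surj_f_inv_f image_iff)
    have "radial_set h \<in> lmeasurable"
      using lmeasure_linear_image[OF lL' RA] by (simp add: Rh)
    moreover have "L ` radial_set h = radial_set (indicator A)"
      unfolding Rh using L(2) by (simp add: image_image bij_is_surj surj_f_inv_f)
    ultimately have meas: "measure lebesgue (radial_set (indicator A :: real^'n \<Rightarrow> ennreal)) =
        \<bar>det (matrix L)\<bar> * measure lebesgue (radial_set h)"
      using lmeasure_linear_image[OF L(1), of "radial_set h"] by simp
    have em: "emeasure lborel S = ennreal (measure lebesgue S)" if "S \<in> lmeasurable" "S \<in> sets borel" for S :: "(real^'n) set"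
    proof -
      have "emeasure lborel S = emeasure lebesgue S" using that(2) by simp
      also have "\<dots> = ennreal (measure lebesgue S)"
        by (rule emeasure_eq_ennreal_measure[OF fmeasurableD2[OF that(1)]])
      finally show ?thesis .
    qed
    have "emeasure (distr (density sphere_measure (\<lambda>u. ennreal (w u))) sphere_borel \<phi>) A
        = (\<integral>\<^sup>+u. ennreal (w u) * indicator (\<phi> -` A \<inter> sphere 0 1) u \<partial>sphere_measure)"
    proof -
      have \<phi>': "\<phi> \<in> sphere_measure \<rightarrow>\<^sub>M sphere_borel" by measurable
      have "emeasure (distr (density sphere_measure (\<lambda>u. ennreal (w u))) sphere_borel \<phi>) A
          = emeasure (density sphere_measure (\<lambda>u. ennreal (w u))) (\<phi> -` A \<inter> sphere 0 1)"
        using \<phi>' A by (subst emeasure_distr) (auto simp: space_sphere_measure)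
      also have "\<dots> = (\<integral>\<^sup>+u. ennreal (w u) * indicator (\<phi> -` A \<inter> sphere 0 1) u \<partial>sphere_measure)"
        using measurable_sets[OF \<phi>' A] by (intro emeasure_density) (simp_all add: space_sphere_measure)
      finally show ?thesis .
    qed
    also have "\<dots> = (\<integral>\<^sup>+u. ennreal \<bar>det (matrix L)\<bar> * h u \<partial>sphere_measure)"
      by (intro nn_integral_cong)
        (auto simp: space_sphere_measure w_def h_def indicator_def ennreal_mult[symmetric])
    also have "\<dots> = ennreal \<bar>det (matrix L)\<bar> * (of_nat CARD('n) * emeasure lborel (radial_set h))"
      using hs h by (simp add: nn_integral_cmult nn_integral_sphere_measure)
    also have "\<dots> = of_nat CARD('n) * emeasure lborel (radial_set (indicator A :: real^'n \<Rightarrow> ennreal))"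
      using RA \<open>radial_set h \<in> lmeasurable\<close> radial_set_borel[OF h] \<open>radial_set (indicator A) \<in> sets borel\<close>
      by (simp add: em meas ennreal_mult mult.left_commute)
    also have "\<dots> = emeasure sphere_measure A" by (simp add: emeasure_sphere_measure[OF A])
    finally show "emeasure (distr (density sphere_measure (\<lambda>u. ennreal (w u))) sphere_borel \<phi>) A =
        emeasure sphere_measure A" .
  qed (simp add: sets_sphere_measure)
qed

text \<open>This is integration against the image measure in
  \<open>distr_density_sphere_measure\<close>. Admitting an arbitrary \<open>F\<close> lets the
  affine surface area integrands be inserted without a proof of their measurability.\<close>

lemma integral_sphere_projective:
  fixes L :: "real^'n \<Rightarrow> real^'n" and F :: "real^'n \<Rightarrow> real"
  assumes L: "linear L" "bij L"
  shows "(LINT u|sphere_measure. F (L u /\<^sub>R norm (L u)) / norm (L u) ^ CARD('n))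
    = (LINT u|sphere_measure. F u) / \<bar>det (matrix L)\<bar>"
proof -
  define \<phi> where "\<phi> = (\<lambda>u. L u /\<^sub>R norm (L u))"
  define w where "w = (\<lambda>u. \<bar>det (matrix L)\<bar> / norm (L u) ^ CARD('n))"
  have det0: "det (matrix L) \<noteq> 0" using det_nz_iff_inj[OF L(1)] L(2) by (simp add: bij_is_inj)
  have L0: "L x = 0 \<longleftrightarrow> x = 0" for x
    using L by (metis bij_is_inj linear_injective_0 linear_0)
  have [measurable]: "L \<in> borel_measurable borel"
    using L(1) by (intro borel_measurable_continuous_onI linear_continuous_on) (simp add: linear_conv_bounded_linear)
  have \<phi>[measurable]: "\<phi> \<in> sphere_borel \<rightarrow>\<^sub>M sphere_borel"
    unfolding \<phi>_def by (rule sphere_projective_measurable[OF L])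
  have w[measurable]: "w \<in> borel_measurable sphere_borel"
    unfolding w_def by (intro measurable_restrict_space1) measurable
  have distr: "distr (density sphere_measure (\<lambda>u. ennreal (w u))) sphere_borel \<phi> = sphere_measure"
    unfolding \<phi>_def w_def by (rule distr_density_sphere_measure[OF L])
  have main: "(LINT u|sphere_measure. w u * F (\<phi> u)) = (LINT u|sphere_measure. F u)"
  proof (cases "F \<in> borel_measurable sphere_borel")
    case F[measurable]: True
    have "(LINT u|sphere_measure. F u) = (LINT u|density sphere_measure (\<lambda>u. ennreal (w u)). F (\<phi> u))"
      by (subst distr[symmetric], rule integral_distr) measurable
    also have "\<dots> = (LINT u|sphere_measure. w u *\<^sub>R F (\<phi> u))"
      by (rule integral_density) (measurable, simp add: w_def)
    finally show ?thesis by simp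
  next
    \<comment> \<open>If \<open>F\<close> is not measurable, then neither is the other integrand, and both integrals are 0 by convention.\<close>
    case False
    let ?L' = "inv L"
    have L': "linear ?L'" "bij ?L'" using L by (auto simp: bij_imp_bij_inv) (metis bij_is_inj inj_linear_imp_inv_linear)
    define \<psi> where "\<psi> = (\<lambda>u. ?L' u /\<^sub>R norm (?L' u))"
    have \<psi>[measurable]: "\<psi> \<in> sphere_borel \<rightarrow>\<^sub>M sphere_borel"
      unfolding \<psi>_def by (rule sphere_projective_measurable[OF L'])
    have \<phi>\<psi>: "\<phi> (\<psi> u) = u" if "norm u = 1" for u
    proof -
      have "?L' u \<noteq> 0" using that L0 L(2) by (metis bij_is_surj norm_zero surj_f_inv_f zero_neq_one)
      then show ?thesis using that L
        by (simp add: \<phi>_def \<psi>_def linear_scale bij_is_surj surj_f_inv_f)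
    qed
    \<comment> \<open>\<open>F\<close> is recovered from this integrand by dividing by
      \<open>w\<close> and composing with \<psi>, a right inverse of \<phi> on the sphere.\<close>
    have "(\<lambda>u. w u * F (\<phi> u)) \<notin> borel_measurable sphere_borel"
    proof
      assume "(\<lambda>u. w u * F (\<phi> u)) \<in> borel_measurable sphere_borel"
      then have [measurable]: "(\<lambda>u. (w u * F (\<phi> u)) / w u) \<in> borel_measurable sphere_borel"
        by measurable
      have "(\<lambda>u. w (\<psi> u) * F (\<phi> (\<psi> u)) / w (\<psi> u)) \<in> borel_measurable sphere_borel"
        by (rule measurable_compose[OF \<psi>, of "\<lambda>u. (w u * F (\<phi> u)) / w u"]) measurable
      also have "?this \<longleftrightarrow> F \<in> borel_measurable sphere_borel"
      proof (rule measurable_cong)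
        fix u :: "real^'n" assume "u \<in> space sphere_borel"
        then have u: "norm u = 1" by (simp add: space_restrict_space)
        then have "\<psi> u \<noteq> 0" using \<phi>\<psi>[OF u] L(1) by (auto simp: \<phi>_def linear_0)
        then have "w (\<psi> u) \<noteq> 0" using det0 by (simp add: w_def L0)
        then show "w (\<psi> u) * F (\<phi> (\<psi> u)) / w (\<psi> u) = F u" using \<phi>\<psi>[OF u] by simp
      qed
      finally show False using False by blast
    qed
    then have "\<not> integrable sphere_measure (\<lambda>u. w u * F (\<phi> u))" "\<not> integrable sphere_measure F"
      using False borel_measurable_integrable measurable_cong_sets[OF sets_sphere_measure refl] by blast+
    then show ?thesis by (simp add: not_integrable_integral_eq)
  qed
  have "(LINT u|sphere_measure. F (\<phi> u) / norm (L u) ^ CARD('n)) =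
      (LINT u|sphere_measure. (w u * F (\<phi> u)) / \<bar>det (matrix L)\<bar>)"
    using det0 by (simp add: w_def)
  also have "\<dots> = (LINT u|sphere_measure. F u) / \<bar>det (matrix L)\<bar>"
    by (simp only: main integral_divide_zero)
  finally show ?thesis by (simp add: \<phi>_def)
qed

section \<open>Transformation of the mixed affine surface area\<close>

theorem lemma2p1:
  fixes K :: "nat \<Rightarrow> (real^'n) set"
    and T :: "real^'n \<Rightarrow> real^'n"
    and p :: ereal
  assumes body: "\<And>i. i \<in> {1..CARD('n)} \<Longrightarrow> convex_body (K i)"
    and smooth: "\<And>i. i \<in> {1..CARD('n)} \<Longrightarrow> C2_plus (K i)"
    and centred: "\<And>i. i \<in> {1..CARD('n)} \<Longrightarrow> centroid (K i) = 0"
    and T: "linear T" "bij T"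
    and p: "p \<noteq> - ereal (real CARD('n))"
  shows "mixed_affine_surface_area p (\<lambda>i. T ` K i) =
           \<bar>det (matrix T)\<bar> powr affine_exponent CARD('n) p * mixed_affine_surface_area p K
       \<and> (\<bar>det (matrix T)\<bar> = 1 \<longrightarrow>
           mixed_affine_surface_area p (\<lambda>i. T ` K i) = mixed_affine_surface_area p K)"
proof -
  let ?n = "CARD('n)" and ?L = "adjoint T"
  define d where "d = \<bar>det (matrix T)\<bar>"
  have d: "d > 0" using det_nz_iff_inj[OF T(1)] T(2) by (simp add: d_def bij_is_inj)
  have L: "linear ?L" by (rule adjoint_linear[OF T(1)])
  have "inj ?L" using adjoint_inv_adjoint[OF T] by (metis injI)
  then have bijL: "bij ?L" using linear_injective_imp_surjective[OF L] by (simp add: bij_def)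
  have detL: "\<bar>det (matrix ?L)\<bar> = d" using T(1) by (simp add: d_def matrix_adjoint)
  note change = integral_sphere_projective[OF L bijL, unfolded detL]
  have L0: "norm (?L u) > 0" if "norm u = 1" for u
    using adjoint_T_nonzero[OF T that] by simp
  have sph: "norm u = 1" if "u \<in> space sphere_measure" for u :: "real^'n"
    using that by (simp add: space_sphere_measure)
  let ?v = "\<lambda>u. ?L u /\<^sub>R norm (?L u)"
  have main: "mixed_affine_surface_area p (\<lambda>i. T ` K i) =
      d powr affine_exponent ?n p * mixed_affine_surface_area p K"
  proof (cases "\<bar>p\<bar> = \<infinity>")
    case True
    \<comment> \<open>Each of the \<open>?n\<close> support functions contributes one factor
      \<open>norm (?L u)\<close>, exactly the power absorbed by \<open>change\<close>, so the
      determinant enters only through the Jacobian.\<close>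
    define F where "F = (\<lambda>u. 1 / (\<Prod>i=1..?n. support_function (K i) u))"
    have "mixed_affine_surface_area p (\<lambda>i. T ` K i) = (LINT u|sphere_measure. F (?v u) / norm (?L u) ^ ?n)"
      unfolding mixed_affine_surface_area_def if_P[OF True]
    proof (rule Bochner_Integration.integral_cong[OF refl])
      fix u :: "real^'n" assume "u \<in> space sphere_measure"
      then have u: "norm u = 1" by (rule sph)
      have "(\<Prod>i=1..?n. support_function (T ` K i) u)
          = (\<Prod>i=1..?n. norm (?L u) * support_function (K i) (?v u))"
        by (intro prod.cong refl support_function_linear_image[OF T body smooth u])
      then show "1 / (\<Prod>i=1..?n. support_function (T ` K i) u) = F (?v u) / norm (?L u) ^ ?n"
        by (simp add: F_def prod.distrib)
    qed
    also have "\<dots> = (LINT u|sphere_measure. F u) / d" by (rule change)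
    also have "\<dots> = d powr affine_exponent ?n p * mixed_affine_surface_area p K"
      using True d by (simp add: F_def affine_exponent_def mixed_affine_surface_area_def powr_minus_divide)
    finally show ?thesis .
  next
    case False
    then obtain r where r: "p = ereal r" by (cases p) auto
    with p have nr: "real ?n + r \<noteq> 0" by auto
    define q where "q = 1 / (real ?n + r)"
    define F where
      "F = (\<lambda>u. (\<Prod>i=1..?n. support_function (K i) u powr (1 - r) * curvature_function (K i) u) powr q)"
    have "mixed_affine_surface_area p (\<lambda>i. T ` K i)
        = (LINT u|sphere_measure. d powr (2 * ?n * q) * (F (?v u) / norm (?L u) ^ ?n))"
      unfolding mixed_affine_surface_area_def if_not_P[OF False[unfolded r]] r real_of_ereal.simps q_def[symmetric] Let_def
    proof (rule Bochner_Integration.integral_cong[OF refl])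
      fix u :: "real^'n" assume "u \<in> space sphere_measure"
      then have u: "norm u = 1" by (rule sph)
      define l where "l = norm (?L u)"
      have l: "l > 0" using L0[OF u] by (simp add: l_def)
      \<comment> \<open>\<open>c\<close> is the factor that each single body contributes to the
        product.\<close>
      define c where "c = l powr (1 - r) * (d\<^sup>2 / l ^ (?n + 1))"
      have "(\<Prod>i=1..?n. support_function (T ` K i) u powr (1 - r) * curvature_function (T ` K i) u)
        = (\<Prod>i=1..?n. c * (support_function (K i) (?v u) powr (1 - r) * curvature_function (K i) (?v u)))"
      proof (rule prod.cong[OF refl])
        fix i assume i: "i \<in> {1..?n}"
        show "support_function (T ` K i) u powr (1 - r) * curvature_function (T ` K i) u
          = c * (support_function (K i) (?v u) powr (1 - r) * curvature_function (K i) (?v u))"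
          unfolding support_function_linear_image[OF T body[OF i] smooth[OF i] u]
            curvature_function_linear_image[OF T body[OF i] smooth[OF i] u]
          by (simp add: c_def l_def d_def powr_mult)
      qed
      then have 1: "(\<Prod>i=1..?n. support_function (T ` K i) u powr (1 - r) * curvature_function (T ` K i) u) powr q
          = (c ^ ?n) powr q * F (?v u)"
        by (simp add: F_def prod.distrib powr_mult)
      \<comment> \<open>The exponent of \<open>l\<close> in \<open>c\<close> is
        \<open>- (real ?n + r)\<close>. Raising \<open>c\<close> to the power \<open>?n * q\<close>
        turns it into \<open>- real ?n\<close>, as required by \<open>change\<close>.\<close>
      have "l powr (1 - r - real (?n + 1)) = l powr (1 - r) / l ^ (?n + 1)"
        using l by (simp only: powr_diff powr_realpow)
      then have "c = d powr 2 * l powr (1 - r - real (?n + 1))"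
        using d by (simp add: c_def)
      also have "1 - r - real (?n + 1) = - (real ?n + r)" by simp
      finally have c: "c = d powr 2 * l powr (- (real ?n + r))" .
      then have "c > 0" using d l by simp
      then have "(c ^ ?n) powr q = c powr (?n * q)"
        by (simp only: powr_realpow[symmetric] powr_powr)
      also have "\<dots> = d powr (2 * ?n * q) * l powr (- (real ?n + r) * (?n * q))"
        by (simp add: c powr_mult powr_powr mult.assoc)
      also have "- (real ?n + r) * (?n * q) = - real ?n" using nr by (simp add: q_def field_simps)
      also have "l powr (- real ?n) = 1 / l ^ ?n" using l by (simp add: powr_minus_divide powr_realpow)
      finally show "(\<Prod>i=1..?n. support_function (T ` K i) u powr (1 - r) * curvature_function (T ` K i) u) powr q
          = d powr (2 * ?n * q) * (F (?v u) / norm (?L u) ^ ?n)"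
        unfolding 1 by (simp add: l_def)
    qed
    also have "\<dots> = d powr (2 * ?n * q) * ((LINT u|sphere_measure. F u) / d)"
      by (simp only: integral_mult_right_zero change)
    also have "\<dots> = d powr (2 * ?n * q - 1) * (LINT u|sphere_measure. F u)"
      using d by (simp add: powr_diff)
    \<comment> \<open>The curvatures give the exponent \<open>2 * ?n * q\<close> of
      \<open>d\<close>, and the Jacobian lowers it by 1.\<close>
    also have "2 * ?n * q - 1 = affine_exponent ?n p"
      using nr by (simp add: q_def affine_exponent_def r field_simps)
    also have "(LINT u|sphere_measure. F u) = mixed_affine_surface_area p K"
      by (simp add: mixed_affine_surface_area_def F_def q_def r)
    finally show ?thesis .
  qed
  then show ?thesis by (auto simp: d_def)
qed

end
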